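(* Let $f:\mathbb D\to\mathbb D$ be analytic, let $\alpha\in\partial\mathbb D$, let $\sigma=\sigma_\alpha$ be the Aleksandrov–Clark measure of $f$ at $\alpha$, and let $$u(z)=\int_{\partial\mathbb D}\frac{1-|z|^2}{|\xi-z|^2}\,d\sigma(\xi),\qquad z\in\mathbb D.$$ The following are equivalent: (a) $f$ is contractive. (b) There is a constant $c>0$ such that $\dfrac{\sigma(I)}{|I|}\ge c\,u(z_I)$ for every arc $I\subset\partial\mathbb D$. (c) $u$ is a Bekollé–Bonami $B_2$ weight, i.e. $$[u]_{B_2}:=\sup_Q\Big(\frac1{A(Q)}\int_Q u\,dA\Big)\Big(\frac1{A(Q)}\int_Q\frac{dA}{u}\Big)<\infty,$$ the supremum being over all Carleson boxes $Q\subset\mathbb D$.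
   Context: $\mathbb D$ is the open unit disc, $m$ is normalized Lebesgue (arc-length) measure on $\partial\mathbb D$ ($m(\partial\mathbb D)=1$), and for an arc $I\subset\partial\mathbb D$ we write $|I|=m(I)$. $dA$ is normalized area measure on $\mathbb D$. For an arc $I$ with center $\xi_I$, $z_I=(1-|I|)\xi_I$. The Carleson box of $I$ is $Q(I)=\{z\in\mathbb D: 1-|z|\le |I|,\ z/|z|\in I\}$. For analytic $f:\mathbb D\to\mathbb D$, the hyperbolic derivative is $D_h(f)(z)=\frac{(1-|z|^2)|f'(z)|}{1-|f(z)|^2}$, and $f$ is called contractive if $\sup_{z\in\mathbb D}D_h(f)(z)<1$. For $\alpha\in\partial\mathbb D$, the Aleksandrov–Clark measure $\sigma_\alpha$ of $f$ is the unique positive finite Borel measure on $\partial\mathbb D$ such that $\frac{1-|f(z)|^2}{|\alpha-f(z)|^2}=\int_{\partial\mathbb D}\frac{1-|z|^2}{|\xi-z|^2}\,d\sigma_\alpha(\xi)$ for all $z\in\mathbb D$. *)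

theory Defs
  imports "HOL-Analysis.Analysis"
begin

definition circle_meas :: "complex measure" where
  "circle_meas = distr (restrict_space lborel {0..1::real}) borel (\<lambda>t. cis (2 * pi * t))"

definition area_meas :: "complex measure" where
  "area_meas = scale_measure (ennreal (1 / pi)) (restrict_space lborel (ball (0::complex) 1))"

text \<open>The closed arc starting at angle 2 pi a of normalized length l (0 < l <= 1).\<close>
definition arc :: "real \<Rightarrow> real \<Rightarrow> complex set" where
  "arc a l = (\<lambda>t. cis (2 * pi * t)) ` {a..a + l}"

definition arc_len :: "complex set \<Rightarrow> real" where
  "arc_len I = measure circle_meas I"

definition arc_center :: "real \<Rightarrow> real \<Rightarrow> complex" where
  "arc_center a l = cis (2 * pi * (a + l / 2))"

definition arc_point :: "real \<Rightarrow> real \<Rightarrow> complex" where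
  "arc_point a l = complex_of_real (1 - arc_len (arc a l)) * arc_center a l"

definition carleson_box :: "complex set \<Rightarrow> complex set" where
  "carleson_box I = {z \<in> ball 0 1. 1 - norm z \<le> arc_len I \<and> sgn z \<in> I}"

definition hyp_deriv :: "(complex \<Rightarrow> complex) \<Rightarrow> complex \<Rightarrow> real" where
  "hyp_deriv f z = (1 - (norm z)\<^sup>2) * norm (deriv f z) / (1 - (norm (f z))\<^sup>2)"

definition contractive :: "(complex \<Rightarrow> complex) \<Rightarrow> bool" where
  "contractive f \<longleftrightarrow> (\<exists>k<1. \<forall>z\<in>ball 0 1. hyp_deriv f z \<le> k)"

definition poisson :: "complex \<Rightarrow> complex \<Rightarrow> real" where
  "poisson z \<xi> = (1 - (norm z)\<^sup>2) / (norm (\<xi> - z))\<^sup>2"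

definition is_AC_measure :: "(complex \<Rightarrow> complex) \<Rightarrow> complex \<Rightarrow> complex measure \<Rightarrow> bool" where
  "is_AC_measure f \<alpha> \<sigma> \<longleftrightarrow>
     sets \<sigma> = sets (restrict_space borel (sphere (0::complex) 1)) \<and>
     finite_measure \<sigma> \<and>
     (\<forall>z\<in>ball 0 1. (1 - (norm (f z))\<^sup>2) / (norm (\<alpha> - f z))\<^sup>2
                      = (\<integral>\<xi>. poisson z \<xi> \<partial>\<sigma>))"

definition B2_const :: "(complex \<Rightarrow> real) \<Rightarrow> ennreal" where
  "B2_const w = (SUP (a, l) \<in> {(a, l). 0 < l \<and> l \<le> 1}.
      (ennreal (1 / measure area_meas (carleson_box (arc a l))) *
         (\<integral>\<^sup>+ z \<in> carleson_box (arc a l). ennreal (w z) \<partial>area_meas)) *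
      (ennreal (1 / measure area_meas (carleson_box (arc a l))) *
         (\<integral>\<^sup>+ z \<in> carleson_box (arc a l). ennreal (1 / w z) \<partial>area_meas)))"

definition B2_weight :: "(complex \<Rightarrow> real) \<Rightarrow> bool" where
  "B2_weight w \<longleftrightarrow> B2_const w < top"

end

theory Submission
  imports Defs "HOL-Complex_Analysis.Complex_Analysis"
begin

text \<open>
  Write \<open>u = Re g\<close> with \<open>g = (\<alpha> + f) / (\<alpha> - f)\<close>; then \<open>D\<^sub>h(f)(z) = (1 - |z|\<^sup>2) |g'(z)| / (2 u(z))\<close>.
  The equivalence is proved as a cycle.

  \<^item> (a) implies (c): contractivity with constant \<open>k < 1\<close> bounds the radial derivative of \<open>log u\<close>, so on
    the box of \<open>I\<close> both \<open>u(z) / u(z\<^sub>I)\<close> and its inverse are at most a constant times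
    \<open>(|I| / (1 - |z|))\<^sup>k\<close>, whose average over the box is bounded because \<open>k < 1\<close>.

  \<^item> (c) implies (b): if \<open>\<sigma>(I) < 2\<^sup>-\<^sup>N |I| u(z\<^sub>I)\<close>, then over the middle half of \<open>I\<close> and at heights
    \<open>2\<^sup>-\<^sup>n |I|\<close> with \<open>n < N\<close> the function \<open>u\<close> is on average at most of order \<open>2\<^sup>-\<^sup>n u(z\<^sub>I)\<close>. Hence each of
    these \<open>N\<close> strips contributes at least a fixed multiple of \<open>|I|\<^sup>2 / u(z\<^sub>I)\<close> to the integral of \<open>1 / u\<close>, and
    the \<open>B\<^sub>2\<close> constant is at least of order \<open>N\<close>.

  \<^item> (b) implies (a): differentiating the Herglotz representation of \<open>g\<close> exhibits \<open>D\<^sub>h(f)(z)\<close> as the modulus of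
    the mean of a unimodular function against a probability measure which, by (b), charges two arcs where
    that function takes well separated values.

  Integrals in polar coordinates are replaced by averaging over rotations, which preserve planar Lebesgue
  measure; the latter follows from the Vitali covering theorem, since rotations map balls to balls.
\<close>

section \<open>Rotations and circle averages\<close>

text \<open>Vitali's covering theorem for the family of all balls inside \<open>S\<close>, encoded
  as pairs (centre, radius). Each point of the open set \<open>S\<close> is the centre of
  arbitrarily small members.\<close>

lemma open_Vitali_balls:
  fixes S :: "'a::euclidean_space set"
  assumes "open S"
  obtains C where "countable C" "\<And>c. c \<in> C \<Longrightarrow> 0 < snd c \<and> ball (fst c) (snd c) \<subseteq> S"
    "disjoint_family_on (\<lambda>c. ball (fst c) (snd c)) C"
    "negligible (S - (\<Union>c\<in>C. ball (fst c) (snd c)))"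
proof -
  define K where "K = {c :: 'a \<times> real. 0 < snd c \<and> ball (fst c) (snd c) \<subseteq> S}"
  have "\<exists>i. i \<in> K \<and> x \<in> ball (fst i) (snd i) \<and> snd i < d" if "x \<in> S" "0 < d" for x d
  proof -
    obtain e where e: "0 < e" "ball x e \<subseteq> S" using \<open>open S\<close> \<open>x \<in> S\<close> openE by blast
    have "ball x (min e (d/2)) \<subseteq> S" using e by (meson min.cobounded1 order_trans subset_ball)
    with e \<open>0 < d\<close> show ?thesis
      by (intro exI[of _ "(x, min e (d/2))"]) (auto simp: K_def)
  qed
  from Vitali_covering_theorem_balls[of S K fst snd, OF this]
  obtain C where C: "countable C" "C \<subseteq> K"
     "pairwise (\<lambda>i j. disjnt (ball (fst i) (snd i)) (ball (fst j) (snd j))) C"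
     "negligible(S - (\<Union>i \<in> C. ball (fst i) (snd i)))" by blast
  show thesis
  proof (rule that[of C])
    show "disjoint_family_on (\<lambda>c. ball (fst c) (snd c)) C"
      using C(3) unfolding disjoint_family_on_def pairwise_def disjnt_def by blast
  qed (use C in \<open>auto simp: K_def\<close>)
qed

text \<open>Up to a null set a box is a countable disjoint union of balls. The inverse map sends
  these to disjoint balls of the same radii, and the null remainder to a null set because it is
  differentiable. Agreement on boxes determines \<open>lborel\<close>.\<close>

lemma distr_lborel_orthogonal_transformation:
  fixes f :: "'a::euclidean_space \<Rightarrow> 'a"
  assumes f: "orthogonal_transformation f"
  shows "distr lborel borel f = lborel"
proof (rule lborel_eqI[symmetric])
  define g where "g = inv f"
  have g: "orthogonal_transformation g" unfolding g_def by (rule orthogonal_transformation_inv[OF f])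
  have bij: "bij f" using f orthogonal_transformation_bij by blast
  have inj_g: "inj g" using g orthogonal_transformation_inj by blast
  have fm: "f \<in> borel \<rightarrow>\<^sub>M borel"
    by (rule borel_measurable_continuous_onI)
      (simp add: f orthogonal_transformation_linear linear_continuous_on linear_linear)
  have lin_g: "linear g" using g orthogonal_transformation_linear by blast
  fix l u :: 'a assume le: "\<And>b. b \<in> Basis \<Longrightarrow> l \<bullet> b \<le> u \<bullet> b"
  let ?B = "\<lambda>c::'a\<times>real. ball (fst c) (snd c)"
  obtain C where C: "countable C" "\<And>c. c \<in> C \<Longrightarrow> 0 < snd c \<and> ?B c \<subseteq> box l u"
    "disjoint_family_on ?B C" "negligible (box l u - (\<Union>c\<in>C. ?B c))"
    using open_Vitali_balls[OF open_box] by blast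
  have imB: "g ` ?B c = ball (g (fst c)) (snd c)" for c
    using image_orthogonal_transformation_ball[OF g] by simp
  have eB: "emeasure lborel (g ` ?B c) = emeasure lborel (?B c)" if "c \<in> C" for c
    using C(2)[OF that] by (subst imB) (simp add: emeasure_ball)
  have op_im: "open (g ` S)" if "open S" for S
    using that lin_g inj_g by (simp add: linear_injective_imp_surjective open_surjective_linear_image)
  have neg2: "negligible (g ` (box l u - (\<Union>c\<in>C. ?B c)))"
    by (rule negligible_differentiable_image_negligible)
      (use C(4) lin_g in \<open>auto simp: linear_imp_differentiable_on\<close>)
  \<comment> \<open>Countable additivity up to a null set; used once for the images of the balls and
    once for the balls themselves.\<close>
  have aux: "emeasure lborel S = (\<integral>\<^sup>+c. emeasure lborel (D c) \<partial>count_space C)"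
    if "open S" "\<And>c. c \<in> C \<Longrightarrow> open (D c) \<and> D c \<subseteq> S" "disjoint_family_on D C" "negligible (S - (\<Union>c\<in>C. D c))"
    for S :: "'a set" and D
  proof -
    have o: "open (\<Union>c\<in>C. D c)" using that(2) by auto
    have z: "emeasure lborel (S - (\<Union>c\<in>C. D c)) = 0"
      using that(4) o \<open>open S\<close> by (simp add: negligible_iff_null_sets null_sets_def)
    have "emeasure lborel S = emeasure lborel ((\<Union>c\<in>C. D c) \<union> (S - (\<Union>c\<in>C. D c)))"
      using that(2) by (intro arg_cong[of _ _ "emeasure lborel"]) auto
    also have "\<dots> = emeasure lborel (\<Union>c\<in>C. D c)"
      by (rule emeasure_Un_null_set) (use o \<open>open S\<close> z in \<open>auto simp: null_sets_def\<close>)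
    also have "\<dots> = (\<integral>\<^sup>+c. emeasure lborel (D c) \<partial>count_space C)"
      by (rule emeasure_UN_countable) (use that C(1) in auto)
    finally show ?thesis .
  qed
  have "emeasure lborel (g ` box l u) = (\<integral>\<^sup>+c. emeasure lborel (g ` ?B c) \<partial>count_space C)"
  proof (rule aux)
    show "open (g ` ball (fst c) (snd c)) \<and> g ` ball (fst c) (snd c) \<subseteq> g ` box l u" if "c \<in> C" for c
      using that C(2) op_im by blast
    show "disjoint_family_on (\<lambda>c. g ` ?B c) C"
      using C(3) inj_g unfolding disjoint_family_on_def by (metis image_Int image_empty)
    have "g ` box l u - (\<Union>c\<in>C. g ` ?B c) = g ` (box l u - (\<Union>c\<in>C. ?B c))"
      using inj_g by (simp add: image_set_diff image_UN)
    then show "negligible (g ` box l u - (\<Union>c\<in>C. g ` ?B c))" using neg2 by simp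
    show "open (g ` box l u)" by (rule op_im[OF open_box])
  qed
  also have "\<dots> = (\<integral>\<^sup>+c. emeasure lborel (?B c) \<partial>count_space C)"
    by (rule nn_integral_cong) (use eB in auto)
  also have "\<dots> = emeasure lborel (box l u)"
    by (rule aux[symmetric]) (use C in auto)
  finally have "emeasure lborel (g ` box l u) = emeasure lborel (box l u)" .
  moreover have "f -` box l u = g ` box l u"
    using bij unfolding g_def by (simp add: bij_vimage_eq_inv_image)
  ultimately show "emeasure (distr lborel borel f) (box l u) = ennreal (\<Prod>b\<in>Basis. (u - l) \<bullet> b)"
    using fm le by (simp add: emeasure_distr emeasure_lborel_box)
qed simp

section \<open>Averaging over circles\<close>

lemma nn_integral_lborel_rotate:
  fixes F :: "complex \<Rightarrow> ennreal"
  assumes [measurable]: "F \<in> borel_measurable borel" and "norm c = 1"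
  shows "(\<integral>\<^sup>+z. F (c * z) \<partial>lborel) = (\<integral>\<^sup>+z. F z \<partial>lborel)"
proof -
  have "orthogonal_transformation ((*) c)"
    using \<open>norm c = 1\<close> by (auto simp: orthogonal_transformation norm_mult linear_iff algebra_simps)
  then have "distr lborel borel ((*) c) = lborel" by (rule distr_lborel_orthogonal_transformation)
  then have "(\<integral>\<^sup>+z. F z \<partial>lborel) = (\<integral>\<^sup>+z. F z \<partial>distr lborel borel ((*) c))" by simp
  also have "\<dots> = (\<integral>\<^sup>+z. F (c * z) \<partial>lborel)" by (subst nn_integral_distr) auto
  finally show ?thesis ..
qed

text \<open>By periodicity only the fractional part \<open>d\<close> of \<open>s\<close> matters.
  The period \<open>{d..<d+1}\<close> is cut at 1 and its second piece is moved back by one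
  period.\<close>

lemma nn_integral_periodic_shift:
  fixes F :: "real \<Rightarrow> ennreal"
  assumes [measurable]: "F \<in> borel_measurable borel" and per: "\<And>t. F (t + 1) = F t"
  shows "(\<integral>\<^sup>+t\<in>{0..1}. F (s + t) \<partial>lborel) = (\<integral>\<^sup>+t\<in>{0..1}. F t \<partial>lborel)"
proof -
  have perz: "F (t + of_int n) = F t" for t n
  proof (induction n rule: int_induct[where k=0])
    case (step1 i) then show ?case using per[of "t + of_int i"] by (simp add: add.assoc)
  next
    case (step2 i) then show ?case using per[of "t + of_int i - 1"] by (simp add: algebra_simps)
  qed simp
  have shift: "(\<integral>\<^sup>+t. G (c + t) \<partial>lborel) = (\<integral>\<^sup>+t. G t \<partial>lborel)"
    if "G \<in> borel_measurable borel" for G :: "real \<Rightarrow> ennreal" and c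
    using nn_integral_real_affine[of G 1 c] that by simp
  define d where "d = frac s"
  have d: "0 \<le> d" "d < 1" by (auto simp: d_def frac_lt_1)
  \<comment> \<open>Single points are null; dropping the endpoint 1 turns the closed period into a
    half-open one, which splits without overlap.\<close>
  have AE1: "AE t in lborel. t \<noteq> (x::real)" for x by (rule AE_lborel_singleton)
  have "(\<integral>\<^sup>+t\<in>{0..1}. F (s + t) \<partial>lborel) = (\<integral>\<^sup>+t. F (d + t) * indicator {d..<d+1} (d + t) \<partial>lborel)"
  proof (rule nn_integral_cong_AE)
    show "AE t in lborel. F (s + t) * indicator {0..1} t = F (d + t) * indicator {d..<d+1} (d + t)"
      using AE1[of 1]
    proof eventually_elim
      case (elim t)
      have "s + t = d + t + of_int \<lfloor>s\<rfloor>" by (simp add: d_def frac_def)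
      then have "F (s + t) = F (d + t)" using perz by metis
      with elim show ?case by (auto simp: indicator_def)
    qed
  qed
  also have "\<dots> = (\<integral>\<^sup>+t. F t * indicator {d..<d+1} t \<partial>lborel)"
    by (rule shift) auto
  also have "\<dots> = (\<integral>\<^sup>+t. F t * indicator {d..<1} t + F t * indicator {1..<d+1} t \<partial>lborel)"
    using d by (intro nn_integral_cong) (auto simp: indicator_def)
  also have "\<dots> = (\<integral>\<^sup>+t. F t * indicator {d..<1} t \<partial>lborel) + (\<integral>\<^sup>+t. F t * indicator {1..<d+1} t \<partial>lborel)"
    by (rule nn_integral_add) auto
  also have "(\<integral>\<^sup>+t. F t * indicator {1..<d+1} t \<partial>lborel) = (\<integral>\<^sup>+t. F (1 + t) * indicator {1..<d+1} (1 + t) \<partial>lborel)"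
    by (rule shift[symmetric]) auto
  also have "\<dots> = (\<integral>\<^sup>+t. F t * indicator {0..<d} t \<partial>lborel)"
    using per by (intro nn_integral_cong) (auto simp: indicator_def add.commute)
  also have "(\<integral>\<^sup>+t. F t * indicator {d..<1} t \<partial>lborel) + \<dots>
      = (\<integral>\<^sup>+t. F t * indicator {d..<1} t + F t * indicator {0..<d} t \<partial>lborel)"
    by (rule nn_integral_add[symmetric]) auto
  also have "\<dots> = (\<integral>\<^sup>+t\<in>{0..1}. F t \<partial>lborel)"
  proof (rule nn_integral_cong_AE)
    show "AE t in lborel. F t * indicator {d..<1} t + F t * indicator {0..<d} t = F t * indicator {0..1} t"
      using AE1[of 1] by eventually_elim (use d in \<open>auto simp: indicator_def\<close>)
  qed
  finally show ?thesis .
qed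

lemma borel_measurable_cis [measurable]: "cis \<in> borel \<rightarrow>\<^sub>M borel"
  by (intro borel_measurable_continuous_onI continuous_on_cis continuous_on_id)

text \<open>The substitute for polar coordinates. The inner integral is the mean of \<open>F\<close>
  over the rotations of \<open>z\<close>, since a periodic shift absorbs the argument of
  \<open>z\<close>; after Fubini each rotation leaves the outer integral unchanged.\<close>

lemma nn_integral_lborel_circle_average:
  fixes F :: "complex \<Rightarrow> ennreal"
  assumes [measurable]: "F \<in> borel_measurable borel"
  shows "(\<integral>\<^sup>+z. F z \<partial>lborel) =
    (\<integral>\<^sup>+z. (\<integral>\<^sup>+t\<in>{0..1}. F (of_real (norm (z::complex)) * cis (2 * pi * t)) \<partial>lborel) \<partial>lborel)"
proof -
  have "(\<integral>\<^sup>+z. (\<integral>\<^sup>+t\<in>{0..1}. F (of_real (norm (z::complex)) * cis (2 * pi * t)) \<partial>lborel) \<partial>lborel)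
    = (\<integral>\<^sup>+z. (\<integral>\<^sup>+t\<in>{0..1}. F (cis (2 * pi * t) * z) \<partial>lborel) \<partial>lborel)"
  proof (rule nn_integral_cong)
    fix z :: complex
    define s where "s = Arg z / (2 * pi)"
    have z: "z = of_real (norm (z::complex)) * cis (2 * pi * s)"
      by (simp add: s_def rcis_cmod_Arg flip: rcis_def)
    have "(\<integral>\<^sup>+t\<in>{0..1}. F (cis (2 * pi * t) * z) \<partial>lborel)
      = (\<integral>\<^sup>+t\<in>{0..1}. F (of_real (norm (z::complex)) * cis (2 * pi * (s + t))) \<partial>lborel)"
      by (subst z) (simp add: cis_mult distrib_left mult_ac flip: cis_mult)
    also have "\<dots> = (\<integral>\<^sup>+t\<in>{0..1}. F (of_real (norm (z::complex)) * cis (2 * pi * t)) \<partial>lborel)"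
      by (rule nn_integral_periodic_shift) (auto simp: distrib_left simp flip: cis_mult)
    finally show "(\<integral>\<^sup>+t\<in>{0..1}. F (of_real (norm (z::complex)) * cis (2 * pi * t)) \<partial>lborel) =
      (\<integral>\<^sup>+t\<in>{0..1}. F (cis (2 * pi * t) * z) \<partial>lborel)" ..
  qed
  also have "\<dots> = (\<integral>\<^sup>+t. (\<integral>\<^sup>+z. F (cis (2 * pi * t) * z) * indicator {0..1} t \<partial>lborel) \<partial>lborel)"
    by (rule lborel_pair.Fubini') measurable
  also have "\<dots> = (\<integral>\<^sup>+t. (\<integral>\<^sup>+z. F z \<partial>lborel) * indicator {0..1::real} t \<partial>lborel)"
    by (intro nn_integral_cong)
       (simp add: nn_integral_multc nn_integral_lborel_rotate)
  also have "\<dots> = (\<integral>\<^sup>+z. F z \<partial>lborel)"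
    by (simp add: nn_integral_cmult_indicator)
  finally show ?thesis ..
qed

section \<open>Arcs and the Poisson kernel\<close>

text \<open>Sine is concave on [0, pi], so on [0, pi/2] it lies above its chord; the other half
  follows by reflection.\<close>

lemma sin_pi_ge:
  assumes "0 \<le> d" "d \<le> x" "x \<le> 1 - d"
  shows "2 * d \<le> sin (pi * x)"
proof -
  have cv: "convex_on {0..pi} (\<lambda>x. - sin x)"
    by (rule f''_ge0_imp_convex[where f' = "\<lambda>x. - cos x" and f'' = sin])
       (auto intro!: derivative_eq_intros simp: sin_ge_zero)
  have half: "2 * y \<le> sin (pi * y)" if "0 \<le> y" "y \<le> 1/2" for y
    using convex_onD[OF cv, of "2 * y" 0 "pi/2"] that by (simp add: mult_ac)
  show ?thesis
  proof (cases "x \<le> 1/2")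
    case True
    with half[of x] assms show ?thesis by linarith
  next
    case False
    have "sin (pi * x) = sin (pi * (1 - x))" by (simp add: right_diff_distrib)
    with half[of "1 - x"] False assms have "2 * (1 - x) \<le> sin (pi * x)" by simp
    with assms show ?thesis by simp
  qed
qed

lemma norm_cis_diff: "norm (cis (2 * pi * s) - cis (2 * pi * t)) = 2 * \<bar>sin (pi * (s - t))\<bar>"
proof -
  have "(norm (cis (2 * pi * s) - cis (2 * pi * t)))\<^sup>2 =
     (cos (2 * pi * s) - cos (2 * pi * t))\<^sup>2 + (sin (2 * pi * s) - sin (2 * pi * t))\<^sup>2"
    by (simp add: cmod_power2)
  also have "\<dots> = 2 - 2 * cos (2 * pi * s - 2 * pi * t)"
    unfolding cos_diff using sin_cos_squared_add[of "2 * pi * s"] sin_cos_squared_add[of "2 * pi * t"]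
    by (simp add: power2_eq_square algebra_simps)
  also have "cos (2 * pi * s - 2 * pi * t) = 1 - 2 * (sin (pi * (s - t)))\<^sup>2"
    using cos_double_sin[of "pi * (s - t)"] by (simp add: algebra_simps)
  finally have "(norm (cis (2 * pi * s) - cis (2 * pi * t)))\<^sup>2 = (2 * \<bar>sin (pi * (s - t))\<bar>)\<^sup>2"
    by (simp add: power_mult_distrib)
  then show ?thesis by (subst (asm) power2_eq_iff_nonneg) auto
qed

lemma norm_cis_diff_le: "norm (cis (2 * pi * s) - cis (2 * pi * t)) \<le> 2 * pi * \<bar>s - t\<bar>"
  using abs_sin_x_le_abs_x[of "pi * (s - t)"] by (simp add: norm_cis_diff abs_mult)

text \<open>The two bounds on \<open>s - t\<close> keep both arcs between the points at normalized
  length at least \<open>d\<close>.\<close>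

lemma norm_cis_diff_ge:
  assumes "0 \<le> d" "d \<le> s - t" "s - t \<le> 1 - d"
  shows "4 * d \<le> norm (cis (2 * pi * s) - cis (2 * pi * t))"
  using sin_pi_ge[OF assms] by (simp add: norm_cis_diff)

lemma cis_eq_iff: "cis (2 * pi * s) = cis (2 * pi * t) \<longleftrightarrow> s - t \<in> \<int>"
proof -
  have "cis (2 * pi * s) = cis (2 * pi * t) \<longleftrightarrow> sin (pi * (s - t)) = 0"
    using norm_cis_diff[of s t] by auto
  also have "\<dots> \<longleftrightarrow> s - t \<in> \<int>"
    by (simp add: mult.commute[of pi] sin_times_pi_eq_0)
  finally show ?thesis .
qed

lemma unit_circle_cis:
  assumes "norm \<xi> = 1"
  obtains t where "a \<le> t" "t < a + 1" "\<xi> = cis (2 * pi * t)"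
proof -
  define s where "s = Arg \<xi> / (2 * pi)"
  have s: "\<xi> = cis (2 * pi * s)"
    using assms rcis_cmod_Arg[of \<xi>] by (simp add: s_def rcis_def)
  define t where "t = a + frac (s - a)"
  have "s - t = of_int \<lfloor>s - a\<rfloor>" by (simp add: t_def frac_def)
  then have "\<xi> = cis (2 * pi * t)" unfolding s cis_eq_iff by simp
  moreover have "a \<le> t" "t < a + 1" by (auto simp: t_def frac_lt_1)
  ultimately show thesis using that by blast
qed

lemma cis_in_arc_iff:
  assumes "a \<le> t" "t < a + 1" "l \<le> 1"
  shows "cis (2 * pi * t) \<in> arc a l \<longleftrightarrow> t \<le> a + l"
proof
  assume "cis (2 * pi * t) \<in> arc a l"
  then obtain s where s: "a \<le> s" "s \<le> a + l" "cis (2 * pi * t) = cis (2 * pi * s)"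
    by (auto simp: arc_def)
  then obtain n where n: "t - s = of_int n" by (metis cis_eq_iff Ints_cases)
  show "t \<le> a + l"
  proof (rule ccontr)
    assume "\<not> t \<le> a + l"
    then have "0 < (of_int n :: real)" "(of_int n :: real) < 1" using n s assms by linarith+
    then show False by simp
  qed
qed (use assms in \<open>auto simp: arc_def\<close>)

lemma closed_arc: "closed (arc a l)"
  unfolding arc_def by (intro compact_imp_closed compact_continuous_image continuous_intros) auto

lemma borel_arc [measurable]: "arc a l \<in> sets borel"
  by (simp add: closed_arc)

lemma arc_subset_sphere: "arc a l \<subseteq> sphere 0 1"
  by (auto simp: arc_def)

lemma nn_integral_arc:
  assumes "0 < l" "l \<le> 1"
  shows "(\<integral>\<^sup>+t\<in>{0..1}. indicator (arc a l) (cis (2 * pi * t)) \<partial>lborel) = ennreal l"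
proof -
  have "(\<integral>\<^sup>+t\<in>{0..1}. indicator (arc a l) (cis (2 * pi * t)) \<partial>lborel)
     = (\<integral>\<^sup>+t\<in>{0..1}. indicator (arc a l) (cis (2 * pi * (a + t))) \<partial>lborel)"
    by (rule nn_integral_periodic_shift[symmetric]) (auto simp: distrib_left simp flip: cis_mult)
  also have "\<dots> = (\<integral>\<^sup>+t. indicator {0..l} t \<partial>lborel)"
  proof (rule nn_integral_cong_AE)
    \<comment> \<open>The parameter 1 is exceptional: it returns to the initial point of the arc
      although it exceeds \<open>l\<close> when \<open>l < 1\<close>.\<close>
    show "AE t in lborel. indicator (arc a l) (cis (2 * pi * (a + t))) * indicator {0..1} t =
       (indicator {0..l} t :: ennreal)"
      using AE_lborel_singleton[of 1]
    proof eventually_elim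
      case (elim t)
      then show ?case using cis_in_arc_iff[of a "a + t" l] assms
        by (cases "0 \<le> t \<and> t < 1") (auto simp: indicator_def)
    qed
  qed
  also have "\<dots> = ennreal l" using assms by simp
  finally show ?thesis .
qed

lemma arc_len_arc:
  assumes "0 < l" "l \<le> 1"
  shows "arc_len (arc a l) = l"
proof -
  have m: "(\<lambda>t. cis (2 * pi * t)) \<in> restrict_space lborel {0..1} \<rightarrow>\<^sub>M borel"
    by (rule measurable_restrict_space1) auto
  have "emeasure circle_meas (arc a l) = (\<integral>\<^sup>+x. indicator (arc a l) x \<partial>circle_meas)"
    by (simp add: circle_meas_def)
  also have "\<dots> = (\<integral>\<^sup>+t. indicator (arc a l) (cis (2 * pi * t)) \<partial>restrict_space lborel {0..1})"
    unfolding circle_meas_def by (rule nn_integral_distr[OF m]) auto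
  also have "\<dots> = ennreal l"
    using nn_integral_arc[OF assms] by (subst nn_integral_restrict_space) auto
  finally show ?thesis using assms by (simp add: arc_len_def measure_def)
qed

lemma arc_point_eq:
  assumes "0 < l" "l \<le> 1"
  shows "arc_point a l = of_real (1 - l) * cis (2 * pi * (a + l / 2))"
  using assms by (simp add: arc_point_def arc_len_arc arc_center_def)

lemma norm_arc_point:
  assumes "0 < l" "l \<le> 1"
  shows "norm (arc_point a l) = 1 - l"
  using assms by (simp add: arc_point_eq norm_mult del: of_real_diff)

section \<open>Boxes, sectors and annuli\<close>

lemma borel_carleson_box [measurable]: "carleson_box (arc a l) \<in> sets borel"
proof -
  have "carleson_box (arc a l) = {z. norm z < 1} \<inter> {z. 1 - norm z \<le> arc_len (arc a l)} \<inter> sgn -` arc a l"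
    by (auto simp: carleson_box_def)
  also have "\<dots> \<in> sets borel"
    unfolding sgn_div_norm by measurable
  finally show ?thesis .
qed

text \<open>The circle average of a radial factor times an angular factor is the radial factor times
  the mean of the angular one, which is the length of the arc.\<close>

lemma nn_integral_lborel_sector:
  fixes h :: "real \<Rightarrow> ennreal"
  assumes [measurable]: "h \<in> borel_measurable borel" and "0 < l" "l \<le> 1"
  shows "(\<integral>\<^sup>+z. h (norm z) * indicator (arc a l) (sgn z) \<partial>lborel) =
    ennreal l * (\<integral>\<^sup>+z. h (norm (z::complex)) \<partial>lborel)"
proof -
  have [measurable]: "(sgn :: complex \<Rightarrow> complex) \<in> borel_measurable borel"
    unfolding sgn_div_norm by measurable
  have "(\<integral>\<^sup>+z. h (norm z) * indicator (arc a l) (sgn z) \<partial>lborel) =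
    (\<integral>\<^sup>+z. (\<integral>\<^sup>+t\<in>{0..1}. h (norm (of_real (norm (z::complex)) * cis (2 * pi * t))) *
        indicator (arc a l) (sgn (of_real (norm z) * cis (2 * pi * t))) \<partial>lborel) \<partial>lborel)"
    by (rule nn_integral_lborel_circle_average) measurable
  also have "\<dots> = (\<integral>\<^sup>+z. ennreal l * h (norm (z::complex)) \<partial>lborel)"
  proof (rule nn_integral_cong_AE)
    \<comment> \<open>The origin is excluded because \<open>sgn 0 = 0\<close> lies on no
      arc.\<close>
    show "AE z in lborel. (\<integral>\<^sup>+t\<in>{0..1}. h (norm (of_real (norm (z::complex)) * cis (2 * pi * t))) *
        indicator (arc a l) (sgn (of_real (norm z) * cis (2 * pi * t))) \<partial>lborel) = ennreal l * h (norm z)"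
      using AE_lborel_singleton[of 0]
    proof eventually_elim
      case (elim z)
      have "sgn (of_real (norm z) * cis (2 * pi * t)) = cis (2 * pi * t)" for t
        using elim by (simp add: sgn_mult sgn_div_norm[of "cis _"] sgn_of_real)
      then have "(\<integral>\<^sup>+t\<in>{0..1}. h (norm (of_real (norm (z::complex)) * cis (2 * pi * t))) *
        indicator (arc a l) (sgn (of_real (norm z) * cis (2 * pi * t))) \<partial>lborel)
        = (\<integral>\<^sup>+t. h (norm z) * (indicator (arc a l) (cis (2 * pi * t)) * indicator {0..1} t) \<partial>lborel)"
        by (simp add: norm_mult mult.assoc)
      also have "\<dots> = h (norm z) * ennreal l"
        using nn_integral_arc[OF assms(2,3)] by (subst nn_integral_cmult) auto
      finally show ?case by (simp add: mult.commute)
    qed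
  qed
  also have "\<dots> = ennreal l * (\<integral>\<^sup>+z. h (norm (z::complex)) \<partial>lborel)"
    by (rule nn_integral_cmult) auto
  finally show ?thesis .
qed

lemma emeasure_lborel_annulus:
  assumes "0 \<le> h'" "h' \<le> h" "h \<le> 1"
  shows "emeasure lborel {z::complex. h' < 1 - norm z \<and> 1 - norm z \<le> h} = ennreal (pi * ((h - h') * (2 - h - h')))"
proof -
  have "{z::complex. h' < 1 - norm z \<and> 1 - norm z \<le> h} = ball 0 (1 - h') - ball 0 (1 - h)"
    by auto
  also have "emeasure lborel \<dots> = emeasure lborel (ball (0::complex) (1 - h')) - emeasure lborel (ball (0::complex) (1 - h))"
    using assms by (intro emeasure_Diff) (auto simp: emeasure_ball)
  also have "\<dots> = ennreal (pi * ((1 - h')^2 - (1 - h)^2))"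
    using assms by (simp add: emeasure_ball unit_ball_vol_2 ennreal_minus right_diff_distrib)
  also have "(1 - h')^2 - (1 - h)^2 = (h - h') * (2 - h - h')" by (simp add: power2_eq_square algebra_simps)
  finally show ?thesis .
qed

section \<open>The Poisson kernel and its circular means\<close>

lemma poisson_eq_Re:
  assumes "norm \<xi> = 1"
  shows "poisson z \<xi> = Re ((\<xi> + z) / (\<xi> - z))"
proof -
  have "Re \<xi> ^ 2 + Im \<xi> ^ 2 = 1" using assms by (metis cmod_power2 one_power2)
  then have *: "1 - ((Re z)\<^sup>2 + (Im z)\<^sup>2) = (Re \<xi> + Re z) * (Re \<xi> - Re z) + (Im \<xi> + Im z) * (Im \<xi> - Im z)"
    by (simp add: power2_eq_square algebra_simps)
  show ?thesis unfolding poisson_def Re_divide cmod_power2 minus_complex.sel plus_complex.sel *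
    by (simp add: add_divide_distrib)
qed

lemma poisson_pos: "norm z < 1 \<Longrightarrow> norm \<xi> = 1 \<Longrightarrow> 0 < poisson z \<xi>"
  unfolding poisson_def by (intro divide_pos_pos) (auto simp: power_less_one_iff abs_square_less_1)

lemma borel_measurable_poisson [measurable]:
  assumes [measurable]: "f \<in> borel_measurable M" "g \<in> borel_measurable M"
  shows "(\<lambda>x. poisson (f x) (g x)) \<in> borel_measurable M"
  unfolding poisson_def by measurable

text \<open>Here \<xi> is fixed and the interior point moves on a circle: the mean value property of
  the harmonic function \<open>poisson _ \<xi>\<close>, whose value at 0 is 1.\<close>

lemma nn_integral_poisson_circle:
  assumes "norm \<xi> = 1" "0 \<le> r" "r < 1"
  shows "(\<integral>\<^sup>+t\<in>{0..1}. ennreal (poisson (of_real r * cis (2 * pi * t)) \<xi>) \<partial>lborel) = 1"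
proof -
  \<comment> \<open>The Herglotz kernel at \<open>r w\<close>. It is holomorphic on the closed disc
    as \<open>r < 1\<close>, so Cauchy's formula at 0 gives its mean, and its real part is the
    Poisson kernel.\<close>
  define h where "h w = (\<xi> + of_real r * w) / (\<xi> - of_real r * w)" for w
  have ne: "\<xi> - of_real r * w \<noteq> 0" if "norm w \<le> 1" for w
  proof
    assume "\<xi> - of_real r * w = 0"
    then have "norm \<xi> = r * norm w" using assms(2) by (simp add: norm_mult)
    also have "\<dots> < 1" using that assms(2,3) mult_left_le[of "norm w" r] by linarith
    finally show False using assms by simp
  qed
  have "h holomorphic_on cball 0 1"
    unfolding h_def by (intro holomorphic_intros) (use ne in auto)
  then have "((\<lambda>w. h w / (w - 0)) has_contour_integral (2 * of_real pi * \<i> * h 0)) (circlepath 0 1)"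
    by (rule Cauchy_integral_circlepath_simple) auto
  moreover have "h 0 = 1" using assms by (auto simp: h_def)
  ultimately have "((\<lambda>w. h w / w) has_contour_integral (2 * of_real pi * \<i>)) (circlepath 0 1)"
    by simp
  then have "((\<lambda>x. h (circlepath 0 1 x) / circlepath 0 1 x * (2 * pi * \<i> * exp (2 * of_real pi * \<i> * x)))
       has_integral 2 * of_real pi * \<i>) {0..1}"
    unfolding has_contour_integral vector_derivative_circlepath by simp
  then have "((\<lambda>x. (2 * pi * \<i>) * h (cis (2 * pi * x))) has_integral (2 * pi * \<i>) * 1) {0..1}"
    by (rule has_integral_eq_rhs[OF has_integral_eq[rotated]])
       (simp_all add: circlepath cis_conv_exp mult_ac)
  then have "((\<lambda>x. h (cis (2 * pi * x))) has_integral 1) {0..1}"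
    by (subst (asm) has_integral_mult_right_iff) auto
  then have "((\<lambda>x. Re (h (cis (2 * pi * x)))) has_integral Re 1) {0..1}"
    by (rule has_integral_linear[OF _ bounded_linear_Re, unfolded o_def])
  then have I: "((\<lambda>x. poisson (of_real r * cis (2 * pi * x)) \<xi>) has_integral 1) {0..1}"
    using assms by (simp add: h_def poisson_eq_Re)
  show ?thesis
    using nn_integral_has_integral_lebesgue'[OF _ I] poisson_pos[OF _ assms(1)] assms(2,3)
    by (simp add: norm_mult less_imp_le)
qed

text \<open>A radial weight is constant on circles, and there the kernel has mean 1. Hypothesis
  \<open>h0\<close> confines the integral to the circles of radius below 1.\<close>

lemma nn_integral_lborel_poisson:
  fixes h :: "real \<Rightarrow> ennreal"
  assumes [measurable]: "h \<in> borel_measurable borel" and "norm \<xi> = 1" and h0: "\<And>r. r \<ge> 1 \<Longrightarrow> h r = 0"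
  shows "(\<integral>\<^sup>+z. h (norm z) * ennreal (poisson z \<xi>) \<partial>lborel) = (\<integral>\<^sup>+z. h (norm (z::complex)) \<partial>lborel)"
proof -
  have "(\<integral>\<^sup>+z. h (norm z) * ennreal (poisson z \<xi>) \<partial>lborel) =
    (\<integral>\<^sup>+z. (\<integral>\<^sup>+t\<in>{0..1}. h (norm (of_real (norm (z::complex)) * cis (2 * pi * t))) *
        ennreal (poisson (of_real (norm z) * cis (2 * pi * t)) \<xi>) \<partial>lborel) \<partial>lborel)"
    by (rule nn_integral_lborel_circle_average) measurable
  also have "\<dots> = (\<integral>\<^sup>+z. h (norm (z::complex)) \<partial>lborel)"
  proof (rule nn_integral_cong)
    fix z :: complex
    have "(\<integral>\<^sup>+t\<in>{0..1}. h (norm (of_real (norm z) * cis (2 * pi * t))) *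
        ennreal (poisson (of_real (norm z) * cis (2 * pi * t)) \<xi>) \<partial>lborel)
       = (\<integral>\<^sup>+t. h (norm z) * (ennreal (poisson (of_real (norm z) * cis (2 * pi * t)) \<xi>) * indicator {0..1} t) \<partial>lborel)"
      by (simp add: norm_mult mult.assoc)
    also have "\<dots> = h (norm z) * (\<integral>\<^sup>+t\<in>{0..1}. ennreal (poisson (of_real (norm z) * cis (2 * pi * t)) \<xi>) \<partial>lborel)"
      by (rule nn_integral_cmult) measurable
    also have "\<dots> = h (norm z)"
      using h0[of "norm z"] nn_integral_poisson_circle[OF assms(2), of "norm z"]
      by (cases "norm z < 1") auto
    finally show "(\<integral>\<^sup>+t\<in>{0..1}. h (norm (of_real (norm z) * cis (2 * pi * t))) *
        ennreal (poisson (of_real (norm z) * cis (2 * pi * t)) \<xi>) \<partial>lborel) = h (norm z)" .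
  qed
  finally show ?thesis .
qed

section \<open>Clark measures and radial growth\<close>

lemma norm_less_one_sq: "norm z < 1 \<Longrightarrow> (norm z)\<^sup>2 < 1"
  by (simp add: abs_square_less_1)

lemma one_minus_norm_sq_ge: "norm z < 1 \<Longrightarrow> 1 - norm z \<le> 1 - (norm z)\<^sup>2"
  using mult_left_le[of "norm z" "norm z"] by (simp add: power2_eq_square)

lemma one_minus_norm_sq_le: "1 - (norm z)\<^sup>2 \<le> 2 * (1 - norm z)"
proof -
  have "0 \<le> (1 - norm z)\<^sup>2" by simp
  then show ?thesis by (simp add: power2_eq_square algebra_simps)
qed

lemma norm_diff_unit_ge: "norm \<xi> = 1 \<Longrightarrow> 1 - norm z \<le> norm (\<xi> - z)"
  using norm_triangle_ineq2[of \<xi> z] by simp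

lemma poisson_le_poisson:
  assumes "norm z < 1" "norm w < 1" "norm \<xi> = 1" "norm (\<xi> - w) \<le> M * norm (\<xi> - z)"
  shows "poisson z \<xi> \<le> M\<^sup>2 * (1 - (norm z)\<^sup>2) / (1 - (norm w)\<^sup>2) * poisson w \<xi>"
proof -
  have pos: "0 < norm (\<xi> - z)" "0 < norm (\<xi> - w)"
    using norm_diff_unit_ge[of \<xi>] assms by (smt (verit))+
  have "(norm (\<xi> - w))\<^sup>2 \<le> M\<^sup>2 * (norm (\<xi> - z))\<^sup>2"
    using power_mono[OF assms(4), of 2] by (simp add: power_mult_distrib)
  then have "1 / (norm (\<xi> - z))\<^sup>2 \<le> M\<^sup>2 / (norm (\<xi> - w))\<^sup>2"
    using pos by (simp add: field_simps)
  then have "(1 - (norm z)\<^sup>2) * (1 / (norm (\<xi> - z))\<^sup>2) \<le> (1 - (norm z)\<^sup>2) * (M\<^sup>2 / (norm (\<xi> - w))\<^sup>2)"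
    using norm_less_one_sq[OF assms(1)] by (intro mult_left_mono) auto
  also have "\<dots> = M\<^sup>2 * (1 - (norm z)\<^sup>2) / (1 - (norm w)\<^sup>2) * poisson w \<xi>"
    using norm_less_one_sq[OF assms(2)] by (simp add: poisson_def mult.commute)
  finally show ?thesis by (simp add: poisson_def)
qed

section \<open>The Clark measure and its Poisson integral\<close>

locale clark_measure =
  fixes f :: "complex \<Rightarrow> complex" and \<alpha> :: complex and \<sigma> :: "complex measure"
    and u :: "complex \<Rightarrow> real"
  assumes analytic: "f analytic_on ball 0 1"
    and maps: "f ` ball 0 1 \<subseteq> ball 0 1"
    and norm_alpha: "norm \<alpha> = 1"
    and AC: "is_AC_measure f \<alpha> \<sigma>"
    and u: "\<And>z. z \<in> ball 0 1 \<Longrightarrow> u z = (\<integral>\<xi>. poisson z \<xi> \<partial>\<sigma>)"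
begin

sublocale finite_measure \<sigma>
  using AC by (simp add: is_AC_measure_def)

lemma sets_sigma: "sets \<sigma> = sets (restrict_space borel (sphere 0 1))"
  using AC by (simp add: is_AC_measure_def)

lemma space_sigma: "space \<sigma> = sphere 0 1"
  using sets_eq_imp_space_eq[OF sets_sigma] by (simp add: space_restrict_space)

lemma measurable_ident_sigma [measurable]: "(\<lambda>\<xi>. \<xi>) \<in> \<sigma> \<rightarrow>\<^sub>M borel"
  using measurable_restrict_space1[of "\<lambda>\<xi>. \<xi>" borel borel "sphere 0 1"]
    measurable_cong_sets[OF sets_sigma refl, of borel] by auto

lemma arc_in_sets [measurable]: "arc a l \<in> sets \<sigma>"
proof -
  have "arc a l = sphere 0 1 \<inter> arc a l" using arc_subset_sphere by blast
  then show ?thesis unfolding sets_sigma sets_restrict_space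
    by (rule image_eqI) (rule borel_arc)
qed

lemma norm_f: "norm z < 1 \<Longrightarrow> norm (f z) < 1"
  using maps by (auto simp: image_subset_iff)

lemma alpha_minus_f: "norm z < 1 \<Longrightarrow> \<alpha> - f z \<noteq> 0"
  using norm_f[of z] norm_alpha by auto

lemma u_eq_f: "norm z < 1 \<Longrightarrow> u z = (1 - (norm (f z))\<^sup>2) / (norm (\<alpha> - f z))\<^sup>2"
  using AC u[of z] by (auto simp: is_AC_measure_def)

lemma u_pos: "norm z < 1 \<Longrightarrow> 0 < u z"
  using alpha_minus_f[of z] norm_less_one_sq[OF norm_f[of z]] by (simp add: u_eq_f)

lemma u_eq_Re: "norm z < 1 \<Longrightarrow> u z = Re ((\<alpha> + f z) / (\<alpha> - f z))"
  using poisson_eq_Re[OF norm_alpha, of "f z"] by (simp add: u_eq_f poisson_def)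

lemma continuous_on_u: "continuous_on (ball 0 1) u"
proof -
  have "continuous_on (ball 0 1) (\<lambda>z. (1 - (norm (f z))\<^sup>2) / (norm (\<alpha> - f z))\<^sup>2)"
    using analytic alpha_minus_f
    by (intro continuous_intros analytic_imp_holomorphic holomorphic_on_imp_continuous_on) auto
  then show ?thesis by (rule continuous_on_eq) (simp add: u_eq_f)
qed

lemma integrable_bounded:
  fixes h :: "complex \<Rightarrow> 'b::{banach,second_countable_topology}"
  assumes "h \<in> borel_measurable \<sigma>" "\<And>\<xi>. norm \<xi> = 1 \<Longrightarrow> norm (h \<xi>) \<le> B"
  shows "integrable \<sigma> h"
  using assms by (intro integrable_const_bound[where B = B] AE_I2) (auto simp: space_sigma)

lemma integrable_poisson:
  assumes "norm z < 1"
  shows "integrable \<sigma> (poisson z)"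
proof (rule integrable_bounded)
  show "poisson z \<in> borel_measurable \<sigma>" by measurable
  fix \<xi> :: complex assume \<xi>: "norm \<xi> = 1"
  have "0 < 1 - norm z" using assms by simp
  then show "norm (poisson z \<xi>) \<le> (1 - (norm z)\<^sup>2) / (1 - norm z)\<^sup>2"
    using poisson_pos[OF assms \<xi>] norm_diff_unit_ge[OF \<xi>, of z] norm_less_one_sq[OF assms]
    by (auto simp: poisson_def intro!: divide_left_mono power_mono mult_pos_pos zero_less_power)
qed

lemma nn_integral_poisson:
  assumes "norm z < 1"
  shows "(\<integral>\<^sup>+\<xi>. ennreal (poisson z \<xi>) \<partial>\<sigma>) = ennreal (u z)"
  using assms poisson_pos[OF assms] u[of z]
  by (subst nn_integral_eq_integral[OF integrable_poisson])
     (auto simp: space_sigma less_imp_le intro!: AE_I2)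

text \<open>Harnack's inequality, obtained kernel by kernel: since \<open>1 - norm z\<close> is at
  most the distance from \<open>z\<close> to \<xi>, the distance from \<open>w\<close> to \<xi> is
  at most \<open>1 + M\<close> times that distance. Integration against \<sigma> preserves the
  bound.\<close>

lemma u_harnack:
  assumes "norm z < 1" "norm w < 1" "0 \<le> M" "norm (w - z) \<le> M * (1 - norm z)"
  shows "u z \<le> (1 + M)\<^sup>2 * (1 - (norm z)\<^sup>2) / (1 - (norm w)\<^sup>2) * u w"
proof -
  let ?C = "(1 + M)\<^sup>2 * (1 - (norm z)\<^sup>2) / (1 - (norm w)\<^sup>2)"
  have "(\<integral>\<xi>. poisson z \<xi> \<partial>\<sigma>) \<le> (\<integral>\<xi>. ?C * poisson w \<xi> \<partial>\<sigma>)"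
  proof (rule integral_mono)
    fix \<xi> assume "\<xi> \<in> space \<sigma>"
    then have \<xi>: "norm \<xi> = 1" by (simp add: space_sigma)
    have "norm (\<xi> - w) \<le> norm (\<xi> - z) + norm (w - z)"
      using norm_triangle_ineq4[of "\<xi> - z" "w - z"] by simp
    also have "\<dots> \<le> norm (\<xi> - z) + M * norm (\<xi> - z)"
      using assms(3,4) norm_diff_unit_ge[OF \<xi>, of z] mult_left_mono order_trans
      by (smt (verit))
    finally have "norm (\<xi> - w) \<le> (1 + M) * norm (\<xi> - z)" by (simp add: algebra_simps)
    then show "poisson z \<xi> \<le> ?C * poisson w \<xi>" by (rule poisson_le_poisson[OF assms(1,2) \<xi>])
  qed (use assms integrable_poisson in auto)
  then show ?thesis using assms u by simp
qed

section \<open>The Herglotz transform and the hyperbolic derivative\<close>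

lemma herglotz_deriv:
  assumes "norm z < 1"
  shows "((\<lambda>z. (\<alpha> + f z) / (\<alpha> - f z)) has_field_derivative 2 * \<alpha> * deriv f z / (\<alpha> - f z)\<^sup>2) (at z)"
proof -
  have "(f has_field_derivative deriv f z) (at z)"
    using analytic assms by (intro analytic_derivI) (auto simp: analytic_on_def)
  then show ?thesis
    using alpha_minus_f[OF assms]
    by (auto intro!: derivative_eq_intros simp: field_simps power2_eq_square)
qed

text \<open>Both \<open>u\<close> and the derivative of the Herglotz transform carry the denominator
  \<open>(norm (\<alpha> - f z))\<^sup>2\<close>, which cancels. Contractivity thus becomes a bound
  on the logarithmic gradient of \<open>u\<close>.\<close>

lemma norm_herglotz_deriv:
  assumes "norm z < 1"
  shows "(1 - (norm z)\<^sup>2) * norm (2 * \<alpha> * deriv f z / (\<alpha> - f z)\<^sup>2) = 2 * u z * hyp_deriv f z"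
proof -
  have "1 - (norm (f z))\<^sup>2 \<noteq> 0" using norm_less_one_sq[OF norm_f[OF assms]] by simp
  moreover have "x * (2 * y / w) = 2 * (v / w) * (x * y / v)" if "v \<noteq> 0" for x y v w :: real
    using that by simp
  moreover have "norm (2 * \<alpha> * deriv f z / (\<alpha> - f z)\<^sup>2) = 2 * norm (deriv f z) / (norm (\<alpha> - f z))\<^sup>2"
    by (simp add: norm_mult norm_divide norm_power norm_alpha)
  ultimately show ?thesis
    unfolding u_eq_f[OF assms] hyp_deriv_def by presburger
qed

text \<open>Along a radius the logarithmic derivative of \<open>u\<close> at distance \<open>t\<close> from the origin is at most
  \<open>2 k / (1 - t\<^sup>2)\<close>.\<close>
lemma contractive_radial_growth:
  assumes k: "0 \<le> k" "k \<le> 1" "\<And>z. norm z < 1 \<Longrightarrow> hyp_deriv f z \<le> k"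
    and \<xi>: "norm \<xi> = 1" and rs: "0 \<le> r" "r \<le> s" "s < 1"
  shows "u (of_real s * \<xi>) \<le> 2 * ((1 - r) / (1 - s)) powr k * u (of_real r * \<xi>)"
    and "u (of_real r * \<xi>) \<le> 2 * ((1 - r) / (1 - s)) powr k * u (of_real s * \<xi>)"
proof -
  let ?g = "\<lambda>z. (\<alpha> + f z) / (\<alpha> - f z)"
  define g' where "g' = (\<lambda>z. 2 * \<alpha> * deriv f z / (\<alpha> - f z)\<^sup>2)"
  define v where "v t = Re (?g (of_real t * \<xi>))" for t
  define v' where "v' t = Re (g' (of_real t * \<xi>) * \<xi>)" for t
  have nrm: "norm (of_real t * \<xi>) < 1" if "0 \<le> t" "t < 1" for t using that \<xi> by (simp add: norm_mult)
  have vu: "v t = u (of_real t * \<xi>)" if "0 \<le> t" "t < 1" for t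
    using u_eq_Re[OF nrm[OF that]] by (simp add: v_def)
  have dv: "(v has_real_derivative v' t) (at t)" if "0 \<le> t" "t < 1" for t
  proof -
    have "((\<lambda>t. ?g (of_real t * \<xi>)) has_vector_derivative (\<xi> * g' (of_real t * \<xi>))) (at t)"
      unfolding o_def[symmetric, of ?g "\<lambda>t. of_real t * \<xi>"]
    proof (rule field_vector_diff_chain_at)
      show "((\<lambda>t. of_real t * \<xi>) has_vector_derivative \<xi>) (at t)"
        by (auto intro!: derivative_eq_intros)
      show "(?g has_field_derivative g' (of_real t * \<xi>)) (at (of_real t * \<xi>))"
        unfolding g'_def by (rule herglotz_deriv[OF nrm[OF that]])
    qed
    then show ?thesis
      unfolding v_def v'_def has_real_derivative_iff_has_vector_derivative
      by (subst mult.commute) (rule bounded_linear.has_vector_derivative[OF bounded_linear_Re])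
  qed
  have bnd: "\<bar>v' t\<bar> \<le> k * (2 / (1 - t\<^sup>2)) * v t" if "0 \<le> t" "t < 1" for t
  proof -
    have t2: "0 < 1 - t\<^sup>2" using that by (simp add: abs_square_less_1)
    have "\<bar>v' t\<bar> \<le> norm (g' (of_real t * \<xi>) * \<xi>)"
      unfolding v'_def by (rule abs_Re_le_cmod)
    then have "(1 - t\<^sup>2) * \<bar>v' t\<bar> \<le> (1 - t\<^sup>2) * norm (g' (of_real t * \<xi>))"
      using \<xi> t2 by (simp add: norm_mult)
    also have "\<dots> = 2 * v t * hyp_deriv f (of_real t * \<xi>)"
      using norm_herglotz_deriv[OF nrm[OF that]] \<xi> that by (simp add: g'_def vu norm_mult)
    also have "\<dots> \<le> 2 * v t * k"
      using k(3)[OF nrm[OF that]] u_pos[OF nrm[OF that]] vu[OF that] by (intro mult_left_mono) auto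
    finally show ?thesis using t2 by (simp add: field_simps)
  qed
  have vpos: "0 < v t" if "0 \<le> t" "t < 1" for t
    using u_pos[OF nrm[OF that]] vu[OF that] by simp
  \<comment> \<open>The primitive of \<open>2 / (1 - t\<^sup>2)\<close>, that is, the hyperbolic
    distance from 0 to \<open>t\<close>.\<close>
  define L where "L t = ln (1 + t) - ln (1 - t)" for t :: real
  have dL: "(L has_real_derivative 2 / (1 - t\<^sup>2)) (at t)" if "0 \<le> t" "t < 1" for t
  proof -
    have "(L has_real_derivative 1 / (1 + t) + 1 / (1 - t)) (at t)"
      unfolding L_def using that by (auto intro!: derivative_eq_intros)
    also have "1 / (1 + t) + 1 / (1 - t) = 2 / (1 - t\<^sup>2)"
    proof -
      have "1 - t\<^sup>2 = (1 + t) * (1 - t)" by (simp add: power2_eq_square algebra_simps)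
      then show ?thesis using that by (simp add: add_frac_eq)
    qed
    finally show ?thesis .
  qed
  \<comment> \<open>The signs \<open>c = 1\<close> and \<open>c = -1\<close> treat the lower and the
    upper growth estimate at once: \<open>k * L\<close> dominates the variation of
    \<open>ln v\<close> in both directions.\<close>
  have mono: "k * L r + c * ln (v r) \<le> k * L s + c * ln (v s)" if c: "\<bar>c\<bar> = 1" for c
  proof (rule DERIV_nonneg_imp_nondecreasing[OF rs(2)])
    fix t assume t: "r \<le> t" "t \<le> s"
    then have t': "0 \<le> t" "t < 1" using rs by auto
    have *: "((\<lambda>t. k * L t + c * ln (v t)) has_real_derivative (k * (2 / (1 - t\<^sup>2)) + c * (1 / v t * v' t))) (at t)"
      using dv[OF t'] dL[OF t'] vpos[OF t'] by (auto intro!: derivative_eq_intros simp: mult_ac)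
    have "\<bar>c * (1 / v t * v' t)\<bar> \<le> k * (2 / (1 - t\<^sup>2))"
      using bnd[OF t'] vpos[OF t'] c by (simp add: abs_mult pos_divide_le_eq)
    have "0 \<le> y + x" if "\<bar>x\<bar> \<le> y" for x y :: real using that by linarith
    from this[OF \<open>\<bar>c * (1 / v t * v' t)\<bar> \<le> _\<close>]
    have "0 \<le> k * (2 / (1 - t\<^sup>2)) + c * (1 / v t * v' t)" .
    with * show "\<exists>y. ((\<lambda>t. k * L t + c * ln (v t)) has_real_derivative y) (at t) \<and> 0 \<le> y"
      by blast
  qed
  have r1: "r < 1" using rs by simp
  \<comment> \<open>Source of the factor 2 in the conclusion: as \<open>k \<le> 1\<close> and
    \<open>(1 + s) / (1 + r) \<le> 2\<close>, the \<open>ln (1 + t)\<close> part of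
    \<open>k * L\<close> grows by at most \<open>ln 2\<close>.\<close>
  have "k * (ln (1 + s) - ln (1 + r)) \<le> 1 * (ln (1 + s) - ln (1 + r))"
    using k rs by (intro mult_right_mono) auto
  also have "\<dots> = ln ((1 + s) / (1 + r))" using rs by (simp add: ln_div)
  also have "\<dots> \<le> ln 2" using rs by (subst ln_le_cancel_iff) (auto simp: field_simps)
  finally have LL: "k * L s - k * L r \<le> ln 2 + k * ln ((1 - r) / (1 - s))"
    using rs by (simp add: L_def ln_div algebra_simps)
  have fin: "x \<le> 2 * ((1 - r) / (1 - s)) powr k * y"
    if "ln x - ln y \<le> k * L s - k * L r" "0 < x" "0 < y" for x y
  proof -
    have "ln x \<le> ln (2 * ((1 - r) / (1 - s)) powr k * y)"
      using that LL rs r1 by (simp add: ln_mult ln_powr)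
    then show ?thesis using that rs r1 by (subst (asm) ln_le_cancel_iff) auto
  qed
  show "u (of_real s * \<xi>) \<le> 2 * ((1 - r) / (1 - s)) powr k * u (of_real r * \<xi>)"
    using mono[of "-1"] rs r1 vpos by (intro fin) (auto simp flip: vu)
  show "u (of_real r * \<xi>) \<le> 2 * ((1 - r) / (1 - s)) powr k * u (of_real s * \<xi>)"
    using mono[of 1] rs r1 vpos by (intro fin) (auto simp flip: vu)
qed

end

section \<open>Contractivity implies the Bekolle--Bonami condition\<close>

lemma area_nn_integral:
  assumes "F \<in> borel_measurable (restrict_space borel (ball 0 1))" and [measurable]: "S \<in> sets borel"
  shows "(\<integral>\<^sup>+z\<in>S. F z \<partial>area_meas) = ennreal (1 / pi) * (\<integral>\<^sup>+z\<in>S \<inter> ball 0 1. F z \<partial>lborel)"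
proof -
  have [measurable]: "F \<in> borel_measurable (restrict_space lborel (ball 0 1))"
    using assms(1) measurable_cong_sets[OF sets_restrict_space_cong[OF sets_lborel] refl] by blast
  have [measurable]: "indicator S \<in> borel_measurable (restrict_space lborel (ball 0 1))"
    by (rule measurable_restrict_space1) simp
  have "(\<integral>\<^sup>+z\<in>S. F z \<partial>area_meas) = ennreal (1 / pi) * (\<integral>\<^sup>+z\<in>S. F z \<partial>restrict_space lborel (ball 0 1))"
    unfolding area_meas_def by (rule nn_integral_scale_measure) simp
  also have "(\<integral>\<^sup>+z\<in>S. F z \<partial>restrict_space lborel (ball 0 1)) = (\<integral>\<^sup>+z\<in>S \<inter> ball 0 1. F z \<partial>lborel)"
    by (subst nn_integral_restrict_space) (auto simp: indicator_def intro!: nn_integral_cong)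
  finally show ?thesis .
qed

lemma nn_integral_carleson_radial:
  fixes h :: "real \<Rightarrow> ennreal"
  assumes [measurable]: "h \<in> borel_measurable borel" and l: "0 < l" "l \<le> 1"
  shows "(\<integral>\<^sup>+z\<in>carleson_box (arc a l). h (norm z) \<partial>area_meas) =
    ennreal (l / pi) * (\<integral>\<^sup>+z\<in>{z::complex. 0 < 1 - norm z \<and> 1 - norm z \<le> l}. h (norm z) \<partial>lborel)"
proof -
  let ?h = "\<lambda>r. h r * indicator {r. 0 < 1 - r \<and> 1 - r \<le> l} r"
  have "(\<integral>\<^sup>+z\<in>carleson_box (arc a l). h (norm z) \<partial>area_meas) =
     ennreal (1 / pi) * (\<integral>\<^sup>+z\<in>carleson_box (arc a l) \<inter> ball 0 1. h (norm z) \<partial>lborel)"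
    by (rule area_nn_integral) (auto intro!: measurable_restrict_space1)
  also have "(\<integral>\<^sup>+z\<in>carleson_box (arc a l) \<inter> ball 0 1. h (norm z) \<partial>lborel) =
      (\<integral>\<^sup>+z. ?h (norm z) * indicator (arc a l) (sgn z) \<partial>lborel)"
    using l by (intro nn_integral_cong) (auto simp: carleson_box_def indicator_def arc_len_arc)
  also have "\<dots> = ennreal l * (\<integral>\<^sup>+z. ?h (norm (z::complex)) \<partial>lborel)"
    by (rule nn_integral_lborel_sector[OF _ l]) measurable
  also have "ennreal (1 / pi) * \<dots> = ennreal (l / pi) * (\<integral>\<^sup>+z. ?h (norm (z::complex)) \<partial>lborel)"
    using l by (simp add: mult.assoc[symmetric] ennreal_mult[symmetric])
  also have "(\<integral>\<^sup>+z. ?h (norm (z::complex)) \<partial>lborel) =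
      (\<integral>\<^sup>+z\<in>{z::complex. 0 < 1 - norm z \<and> 1 - norm z \<le> l}. h (norm z) \<partial>lborel)"
    by (intro nn_integral_cong) (auto simp: indicator_def)
  finally show ?thesis .
qed

lemma measure_carleson_box:
  assumes l: "0 < l" "l \<le> 1"
  shows "measure area_meas (carleson_box (arc a l)) = l\<^sup>2 * (2 - l)"
proof -
  have Q: "carleson_box (arc a l) \<in> sets area_meas"
  proof -
    have "carleson_box (arc a l) = ball 0 1 \<inter> carleson_box (arc a l)" by (auto simp: carleson_box_def)
    then have "carleson_box (arc a l) \<in> sets (restrict_space lborel (ball 0 1))"
      unfolding sets_restrict_space by (rule image_eqI) simp
    then show ?thesis by (simp add: area_meas_def)
  qed
  have "emeasure area_meas (carleson_box (arc a l)) = (\<integral>\<^sup>+z\<in>carleson_box (arc a l). 1 \<partial>area_meas)"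
    using Q by simp
  also have "\<dots> = ennreal (l / pi) * (\<integral>\<^sup>+z\<in>{z::complex. 0 < 1 - norm z \<and> 1 - norm z \<le> l}. 1 \<partial>lborel)"
    by (rule nn_integral_carleson_radial) (use l in auto)
  also have "\<dots> = ennreal (l / pi) * emeasure lborel {z::complex. 0 < 1 - norm z \<and> 1 - norm z \<le> l}"
    by simp
  also have "\<dots> = ennreal (l\<^sup>2 * (2 - l))"
    using l emeasure_lborel_annulus[of 0 l]
    by (simp add: ennreal_mult[symmetric] power2_eq_square)
  finally show ?thesis using l by (simp add: measure_def)
qed

lemma dyadic_scale:
  assumes "0 < x" "x \<le> (l::real)"
  obtains n :: nat where "l / 2 ^ Suc n < x" "x \<le> l / 2 ^ n"
proof -
  have l: "0 < l" using assms by simp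
  obtain m :: nat where "(1/2) ^ m < x / l"
    using real_arch_pow_inv[of "x / l" "1/2"] assms l by auto
  then have m: "l / 2 ^ m < x" using l by (simp add: power_one_over field_simps)
  define N where "N = (LEAST m. l / 2 ^ m < x)"
  have N: "l / 2 ^ N < x" unfolding N_def by (rule LeastI) (rule m)
  have "N \<noteq> 0" using N assms by (metis div_by_1 not_le power_0)
  then obtain n where n: "N = Suc n" using not0_implies_Suc by blast
  have "\<not> l / 2 ^ n < x" using not_less_Least[of n "\<lambda>m. l / 2 ^ m < x"] n by (simp add: N_def)
  then show thesis using that[of n] N n by simp
qed

text \<open>At distance about \<open>l / 2 ^ n\<close> from the circle the integrand is of order
  \<open>2 powr (k * n)\<close>, on a set of area of order \<open>l / 2 ^ n\<close>. The resulting
  geometric series has ratio \<open>2 powr (k - 1)\<close>, below 1 exactly because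
  \<open>k < 1\<close>.\<close>

lemma nn_integral_boundary_distance_powr:
  assumes k: "0 \<le> k" "k < 1" and l: "0 < l" "l \<le> 1"
  shows "(\<integral>\<^sup>+z\<in>{z::complex. 0 < 1 - norm z \<and> 1 - norm z \<le> l}. ennreal ((l / (1 - norm z)) powr k) \<partial>lborel)
    \<le> ennreal (4 * pi * l / (1 - 2 powr (k - 1)))"
proof -
  have le_suminf: "g n \<le> (\<Sum>n. g n)" for g :: "nat \<Rightarrow> ennreal" and n
    using sum_le_suminf[OF summableI, of "{n}" g] by simp
  \<comment> \<open>Nested layers reaching up to the circle rather than disjoint annuli; the overlap
    only enlarges the upper bound.\<close>
  let ?D = "\<lambda>n::nat. {z::complex. 0 < 1 - norm z \<and> 1 - norm z \<le> l / 2 ^ n}"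
  have q: "0 \<le> 2 powr (k - 1)" "2 powr (k - 1) < 1"
    using k powr_less_mono[of "k - 1" 0 2] by auto
  have "(\<integral>\<^sup>+z\<in>{z::complex. 0 < 1 - norm z \<and> 1 - norm z \<le> l}. ennreal ((l / (1 - norm z)) powr k) \<partial>lborel)
     \<le> (\<integral>\<^sup>+z. (\<Sum>n. ennreal (2 * (2 powr k) ^ n) * indicator (?D n) z) \<partial>lborel)"
  proof (rule nn_integral_mono)
    fix z :: complex
    show "ennreal ((l / (1 - norm z)) powr k) * indicator {z. 0 < 1 - norm z \<and> 1 - norm z \<le> l} z
      \<le> (\<Sum>n. ennreal (2 * (2 powr k) ^ n) * indicator (?D n) z)"
    proof (cases "0 < 1 - norm z \<and> 1 - norm z \<le> l")
      case True
      then obtain n where n: "l / 2 ^ Suc n < 1 - norm z" "1 - norm z \<le> l / 2 ^ n"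
        using dyadic_scale by blast
      have "l / (1 - norm z) \<le> 2 ^ Suc n" using n True by (simp add: field_simps)
      then have "(l / (1 - norm z)) powr k \<le> (2 ^ Suc n) powr k"
        using True l k by (intro powr_mono2) auto
      also have "\<dots> = 2 powr k * (2 powr k) ^ n"
        by (simp add: powr_mult powr_power powr_powr mult.commute flip: powr_realpow)
      also have "\<dots> \<le> 2 * (2 powr k) ^ n"
        using k powr_mono[of k 1 2] by (intro mult_right_mono) auto
      finally have "ennreal ((l / (1 - norm z)) powr k) * indicator {z. 0 < 1 - norm z \<and> 1 - norm z \<le> l} z
         \<le> ennreal (2 * (2 powr k) ^ n) * indicator (?D n) z"
        using True n by (simp add: ennreal_leI)
      also have "\<dots> \<le> (\<Sum>n. ennreal (2 * (2 powr k) ^ n) * indicator (?D n) z)"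
        by (rule le_suminf[of "\<lambda>n. ennreal (2 * (2 powr k) ^ n) * indicator (?D n) z"])
      finally show ?thesis .
    qed simp
  qed
  also have "\<dots> = (\<Sum>n. \<integral>\<^sup>+z. ennreal (2 * (2 powr k) ^ n) * indicator (?D n) z \<partial>lborel)"
    by (rule nn_integral_suminf) measurable
  also have "\<dots> \<le> (\<Sum>n. ennreal (4 * pi * l * (2 powr (k - 1)) ^ n))"
  proof (rule suminf_le)
    fix n
    have h: "0 \<le> l / 2 ^ n" "l / 2 ^ n \<le> 1"
      using l by (auto simp: divide_le_eq intro: order_trans[OF _ one_le_power])
    have "(\<integral>\<^sup>+z. ennreal (2 * (2 powr k) ^ n) * indicator (?D n) z \<partial>lborel)
      = ennreal (2 * (2 powr k) ^ n) * emeasure lborel (?D n)"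
      by (rule nn_integral_cmult_indicator) measurable
    also have "\<dots> = ennreal (2 * (2 powr k) ^ n * (pi * (l / 2 ^ n * (2 - l / 2 ^ n))))"
      using emeasure_lborel_annulus[OF order_refl h]
      by (simp only: diff_zero) (rule ennreal_mult'[symmetric], simp)
    also have "\<dots> \<le> ennreal (2 * (2 powr k) ^ n * (pi * (l / 2 ^ n * 2)))"
      using h by (intro ennreal_leI mult_left_mono) auto
    also have "2 * (2 powr k) ^ n * (pi * (l / 2 ^ n * 2)) = 4 * pi * l * (2 powr (k - 1)) ^ n"
      by (simp add: powr_diff power_divide)
    finally show "(\<integral>\<^sup>+z. ennreal (2 * (2 powr k) ^ n) * indicator (?D n) z \<partial>lborel)
        \<le> ennreal (4 * pi * l * (2 powr (k - 1)) ^ n)" .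
  qed auto
  also have "\<dots> = ennreal (4 * pi * l / (1 - 2 powr (k - 1)))"
  proof (rule suminf_ennreal_eq)
    show "(\<lambda>n. 4 * pi * l * (2 powr (k - 1)) ^ n) sums (4 * pi * l / (1 - 2 powr (k - 1)))"
      using sums_mult[OF geometric_sums[of "2 powr (k - 1)"], of "4 * pi * l"] q by simp
  qed (use l in auto)
  finally show ?thesis .
qed

text \<open>The bound is independent of the box: the angular factor \<open>l / pi\<close> and the
  radial integral, of order \<open>l\<close>, together match the area, of order
  \<open>l\<^sup>2\<close>.\<close>

lemma carleson_average_le:
  assumes k: "0 \<le> k" "k < 1" and l: "0 < l" "l \<le> 1" and c: "0 \<le> c"
    and F: "\<And>z. z \<in> carleson_box (arc a l) \<Longrightarrow> F z \<le> c * (l / (1 - norm z)) powr k"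
  shows "ennreal (1 / measure area_meas (carleson_box (arc a l))) *
    (\<integral>\<^sup>+z\<in>carleson_box (arc a l). ennreal (F z) \<partial>area_meas) \<le> ennreal (c * (4 / (1 - 2 powr (k - 1))))"
proof -
  have q: "2 powr (k - 1) < 1" using k powr_less_mono[of "k - 1" 0 2] by auto
  let ?D = "{z::complex. 0 < 1 - norm z \<and> 1 - norm z \<le> l}"
  let ?E = "4 * pi * l / (1 - 2 powr (k - 1))"
  have "(\<integral>\<^sup>+z\<in>carleson_box (arc a l). ennreal (F z) \<partial>area_meas)
    \<le> (\<integral>\<^sup>+z\<in>carleson_box (arc a l). ennreal (c * (l / (1 - norm z)) powr k) \<partial>area_meas)"
    using F by (intro nn_integral_mono) (auto simp: indicator_def ennreal_leI)
  also have "\<dots> = ennreal (l / pi) * (\<integral>\<^sup>+z\<in>?D. ennreal (c * (l / (1 - norm z)) powr k) \<partial>lborel)"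
    by (rule nn_integral_carleson_radial) (use l in auto)
  also have "(\<integral>\<^sup>+z\<in>?D. ennreal (c * (l / (1 - norm z)) powr k) \<partial>lborel) =
      ennreal c * (\<integral>\<^sup>+z\<in>?D. ennreal ((l / (1 - norm z)) powr k) \<partial>lborel)"
    using c by (subst nn_integral_cmult[symmetric]) (auto simp: ennreal_mult mult.assoc)
  also have "ennreal (l / pi) * \<dots> \<le> ennreal (l / pi) * (ennreal c * ennreal ?E)"
    by (intro mult_left_mono nn_integral_boundary_distance_powr[OF k l]) auto
  finally have "ennreal (1 / measure area_meas (carleson_box (arc a l))) *
      (\<integral>\<^sup>+z\<in>carleson_box (arc a l). ennreal (F z) \<partial>area_meas)
    \<le> ennreal (1 / (l\<^sup>2 * (2 - l))) * (ennreal (l / pi) * (ennreal c * ennreal ?E))"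
    using l by (simp add: measure_carleson_box mult_left_mono)
  also have "\<dots> = ennreal (1 / (l\<^sup>2 * (2 - l)) * (l / pi * (c * ?E)))"
  proof -
    have mult: "ennreal x * (ennreal y * (ennreal c * ennreal e)) = ennreal (x * (y * (c * e)))"
      if "0 \<le> x" "0 \<le> y" for x y e
      using that c by (simp add: ennreal_mult')
    show ?thesis by (rule mult) (use l in auto)
  qed
  also have "1 / (l\<^sup>2 * (2 - l)) * (l / pi * (c * ?E)) = (c * (4 / (1 - 2 powr (k - 1)))) * (1 / (2 - l))"
    using l by (simp add: power2_eq_square)
  also have "\<dots> \<le> (c * (4 / (1 - 2 powr (k - 1)))) * 1"
    using c l q by (intro mult_left_mono) auto
  finally show ?thesis by (simp add: ennreal_leI)
qed

context clark_measure
begin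

text \<open>On the box of an arc, \<open>u\<close> and \<open>1 / u\<close> are compared with their
  values at \<open>zI\<close>. These values are reciprocal and cancel in the product of the
  averages.\<close>

lemma contractive_imp_B2_weight:
  assumes "contractive f"
  shows "B2_weight u"
proof -
  obtain k where k: "k < 1" "\<And>z. norm z < 1 \<Longrightarrow> hyp_deriv f z \<le> k"
    using assms by (auto simp: contractive_def)
  \<comment> \<open>Any value of the hyperbolic derivative is nonnegative, which forces
    \<open>k\<close> to be so.\<close>
  have "0 \<le> hyp_deriv f 0"
    using norm_less_one_sq[OF norm_f[of 0]] by (simp add: hyp_deriv_def)
  then have k0: "0 \<le> k" using k(2)[of 0] by simp
  \<comment> \<open>The 2 comes from the radial growth estimate, \<open>(1 + pi)\<^sup>2\<close>
    from Harnack's inequality between two points at height \<open>l\<close>.\<close>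
  define C where "C = 2 * (1 + pi)\<^sup>2"
  define E where "E = 4 / (1 - 2 powr (k - 1))"
  have "2 powr (k - 1) < 1" using k powr_less_mono[of "k - 1" 0 2] by auto
  then have E: "0 \<le> E" by (simp add: E_def)
  have C: "0 < C" unfolding C_def by (intro mult_pos_pos zero_less_power add_pos_pos) auto
  have main: "ennreal (1 / measure area_meas (carleson_box (arc a l))) *
         (\<integral>\<^sup>+ z \<in> carleson_box (arc a l). ennreal (u z) \<partial>area_meas) *
      (ennreal (1 / measure area_meas (carleson_box (arc a l))) *
         (\<integral>\<^sup>+ z \<in> carleson_box (arc a l). ennreal (1 / u z) \<partial>area_meas)) \<le> ennreal ((C * E)\<^sup>2)"
    if l: "0 < l" "l \<le> 1" for a l
  proof -
    define zI where "zI = arc_point a l"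
    have nI: "norm zI = 1 - l" using norm_arc_point l by (simp add: zI_def)
    then have uI: "0 < u zI" using l by (intro u_pos) simp
    have bounds: "u z \<le> (C * u zI) * (l / (1 - norm z)) powr k \<and> u zI \<le> C * u z * (l / (1 - norm z)) powr k"
      if "z \<in> carleson_box (arc a l)" for z
    proof -
      have z: "norm z < 1" "1 - norm z \<le> l" "sgn z \<in> arc a l"
        using that l by (auto simp: carleson_box_def arc_len_arc)
      then have ns: "norm (sgn z) = 1" using arc_subset_sphere[of a l] by auto
      obtain t where t: "a \<le> t" "t \<le> a + l" "sgn z = cis (2 * pi * t)"
        using z(3) by (auto simp: arc_def)
      \<comment> \<open>The point on the radius of \<open>z\<close> at the height of
        \<open>zI\<close>. From \<open>zI\<close> to \<open>w\<close> Harnack's inequality applies,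
        from \<open>w\<close> to \<open>z\<close> the radial growth estimate.\<close>
      define w where "w = of_real (1 - l) * sgn z"
      have nw: "norm w = 1 - l" using l ns by (simp add: w_def norm_mult del: of_real_diff)
      have "w - zI = of_real (1 - l) * (cis (2 * pi * t) - cis (2 * pi * (a + l / 2)))"
        using l t by (simp add: w_def zI_def arc_point_eq algebra_simps)
      then have "norm (w - zI) = (1 - l) * norm (cis (2 * pi * t) - cis (2 * pi * (a + l / 2)))"
        using l by (simp add: norm_mult del: of_real_diff)
      also have "\<dots> \<le> 1 * (2 * pi * \<bar>t - (a + l / 2)\<bar>)"
        using l norm_cis_diff_le by (intro mult_mono) auto
      also have "\<dots> \<le> 2 * pi * (l / 2)"
        using t by (simp add: abs_if)
      finally have d: "norm (w - zI) \<le> pi * l" by simp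
      \<comment> \<open>Since \<open>w\<close> and \<open>zI\<close> have the same modulus, the
        quotient in Harnack's inequality is 1 once its denominator is known to be nonzero.\<close>
      have r0: "(1 - (1 - l)\<^sup>2) \<noteq> 0" using l by (simp add: power2_eq_square algebra_simps)
      have h1: "u zI \<le> (1 + pi)\<^sup>2 * u w"
        using u_harnack[of zI w pi] d nw nI l r0 by simp
      have h2: "u w \<le> (1 + pi)\<^sup>2 * u zI"
        using u_harnack[of w zI pi] d nw nI l r0 by (simp add: norm_minus_commute)
      have zeq: "z = of_real (norm z) * sgn z"
        by (simp add: sgn_eq)
      have g1: "u z \<le> 2 * (l / (1 - norm z)) powr k * u w"
        using contractive_radial_growth(1)[OF k0 _ k(2) ns, of "1 - l" "norm z"] k(1) z l zeq by (simp add: w_def)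
      have g2: "u w \<le> 2 * (l / (1 - norm z)) powr k * u z"
        using contractive_radial_growth(2)[OF k0 _ k(2) ns, of "1 - l" "norm z"] k(1) z l zeq by (simp add: w_def)
      have "u z \<le> 2 * (l / (1 - norm z)) powr k * ((1 + pi)\<^sup>2 * u zI)"
        using g1 h2 by (elim order_trans) (intro mult_left_mono, auto)
      moreover have "u zI \<le> (1 + pi)\<^sup>2 * (2 * (l / (1 - norm z)) powr k * u z)"
        using h1 g2 by (elim order_trans) (intro mult_left_mono, auto)
      ultimately show ?thesis by (simp add: C_def mult_ac)
    qed
    have inv: "1 / u z \<le> (C / u zI) * (l / (1 - norm z)) powr k" if "z \<in> carleson_box (arc a l)" for z
    proof -
      have "0 < u z" using that by (intro u_pos) (auto simp: carleson_box_def)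
      then show ?thesis using bounds[OF that] uI by (simp add: field_simps)
    qed
    have "ennreal (1 / measure area_meas (carleson_box (arc a l))) *
         (\<integral>\<^sup>+ z \<in> carleson_box (arc a l). ennreal (u z) \<partial>area_meas) *
      (ennreal (1 / measure area_meas (carleson_box (arc a l))) *
         (\<integral>\<^sup>+ z \<in> carleson_box (arc a l). ennreal (1 / u z) \<partial>area_meas))
      \<le> ennreal (C * u zI * E) * ennreal (C / u zI * E)"
      unfolding E_def using C uI k k0 l bounds inv by (intro mult_mono carleson_average_le) auto
    also have "\<dots> = ennreal ((C * E)\<^sup>2)"
      using C uI E by (simp add: ennreal_mult[symmetric] power2_eq_square)
    finally show ?thesis .
  qed
  have "B2_const u \<le> ennreal ((C * E)\<^sup>2)"
    unfolding B2_const_def by (rule SUP_least) (use main in auto)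
  also have "\<dots> < top" by simp
  finally show ?thesis by (simp add: B2_weight_def)
qed

end

section \<open>The Bekolle--Bonami condition implies the arc bound\<close>

text \<open>Heights are half-open so that different strips are disjoint. Only the middle half of the
  arc is taken, so that boundary points outside the arc stay at distance comparable to
  \<open>l\<close>.\<close>

definition strip :: "real \<Rightarrow> real \<Rightarrow> nat \<Rightarrow> complex set" where
  "strip a l n = {z. l / 2 ^ Suc n < 1 - norm z \<and> 1 - norm z \<le> l / 2 ^ n \<and> sgn z \<in> arc (a + l / 4) (l / 2)}"

lemma dyadic_le: "0 < l \<Longrightarrow> l / 2 ^ n \<le> (l::real)"
  by (simp add: divide_le_eq mult_le_cancel_left1)

lemma dyadic_bounds:
  assumes "0 < l" "l \<le> (1::real)"
  shows "0 < l / 2 ^ n" "l / 2 ^ n \<le> 1"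
  using assms dyadic_le[of l n] by (simp, linarith)

lemma strip_norm: "0 < l \<Longrightarrow> z \<in> strip a l n \<Longrightarrow> norm z < 1"
  using divide_pos_pos[of l "2 ^ Suc n"] by (simp add: strip_def)

lemma arc_middle_subset: "0 < l \<Longrightarrow> arc (a + l / 4) (l / 2) \<subseteq> arc a l"
  unfolding arc_def by (intro image_mono) auto

lemma strip_subset_carleson_box:
  assumes "0 < l" "l \<le> 1"
  shows "strip a l n \<subseteq> carleson_box (arc a l)"
  using arc_middle_subset[OF assms(1)] strip_norm[OF assms(1)] dyadic_le[OF assms(1), of n] assms
  by (fastforce simp: carleson_box_def strip_def arc_len_arc)

lemma borel_strip [measurable]: "strip a l n \<in> sets borel"
proof -
  have "strip a l n = {z. l / 2 ^ Suc n < 1 - norm z} \<inter> {z. 1 - norm z \<le> l / 2 ^ n} \<inter> sgn -` arc (a + l / 4) (l / 2)"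
    by (auto simp: strip_def)
  also have "\<dots> \<in> sets borel"
    unfolding sgn_div_norm by measurable
  finally show ?thesis .
qed

lemma disjoint_strips:
  assumes "0 < l"
  shows "disjoint_family (strip a l)"
proof -
  have "False" if z: "z \<in> strip a l n" "z \<in> strip a l m" and nm: "n < m" for z n m
  proof -
    have "l / 2 ^ m \<le> l / 2 ^ Suc n"
      using nm assms by (intro divide_left_mono power_increasing) auto
    then show False using z by (auto simp: strip_def)
  qed
  then show ?thesis
    unfolding disjoint_family_on_def by (metis disjoint_iff linorder_neqE_nat)
qed

lemma emeasure_lborel_dyadic_annulus:
  assumes "0 < l" "l \<le> 1"
  shows "emeasure lborel {z::complex. l / 2 ^ Suc n < 1 - norm z \<and> 1 - norm z \<le> l / 2 ^ n} =
     ennreal (pi * (l / 2 ^ n / 2 * (2 - 3 / 2 * (l / 2 ^ n))))"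
proof -
  define h where "h = l / 2 ^ n"
  have h: "0 < h" "h \<le> 1" using dyadic_bounds[OF assms] by (auto simp only: h_def)
  have h2: "l / 2 ^ Suc n = h / 2" by (simp add: h_def)
  show ?thesis
    unfolding h2 h_def[symmetric]
    using emeasure_lborel_annulus[of "h / 2" h] h by simp
qed

lemma emeasure_strip:
  assumes l: "0 < l" "l \<le> 1"
  shows "emeasure lborel (strip a l n) = ennreal (l / 2 * (pi * (l / 2 ^ n / 2 * (2 - 3 / 2 * (l / 2 ^ n)))))"
proof -
  let ?A = "{r. l / 2 ^ Suc n < 1 - r \<and> 1 - r \<le> l / 2 ^ n}"
  have "emeasure lborel (strip a l n) = (\<integral>\<^sup>+z. indicator (strip a l n) z \<partial>lborel)" by simp
  also have "\<dots> = (\<integral>\<^sup>+z. indicator ?A (norm z) * indicator (arc (a + l / 4) (l / 2)) (sgn z) \<partial>lborel)"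
    by (intro nn_integral_cong) (auto simp: strip_def indicator_def)
  also have "\<dots> = ennreal (l / 2) * (\<integral>\<^sup>+z. indicator ?A (norm (z::complex)) \<partial>lborel)"
    by (rule nn_integral_lborel_sector) (use l in auto)
  also have "(\<integral>\<^sup>+z. indicator ?A (norm (z::complex)) \<partial>lborel) =
     (\<integral>\<^sup>+z. indicator {z::complex. l / 2 ^ Suc n < 1 - norm z \<and> 1 - norm z \<le> l / 2 ^ n} z \<partial>lborel)"
    by (intro nn_integral_cong) (auto simp: indicator_def)
  also have "\<dots> = ennreal (pi * (l / 2 ^ n / 2 * (2 - 3 / 2 * (l / 2 ^ n))))"
    using emeasure_lborel_dyadic_annulus[OF l] by simp
  also have "ennreal (l / 2) * \<dots> = ennreal (l / 2 * (pi * (l / 2 ^ n / 2 * (2 - 3 / 2 * (l / 2 ^ n)))))"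
    using l by (intro ennreal_mult'[symmetric]) auto
  finally show ?thesis .
qed

lemma emeasure_strip_bounds:
  assumes l: "0 < l" "l \<le> 1"
  shows "emeasure lborel (strip a l n) \<le> ennreal (pi * l * (l / 2 ^ n) / 2)"
    and "ennreal (pi * l * (l / 2 ^ n) / 8) \<le> emeasure lborel (strip a l n)"
proof -
  define h where "h = l / 2 ^ n"
  have h: "0 < h" "h \<le> 1" using dyadic_bounds[OF l] by (auto simp only: h_def)
  \<comment> \<open>The last factor lies between 1/8 and 1/2 because
    \<open>0 < h \<le> 1\<close>.\<close>
  have *: "l / 2 * (pi * (h / 2 * (2 - 3 / 2 * h))) = (pi * l * h) * ((2 - 3 / 2 * h) / 4)" by simp
  have p: "0 \<le> pi * l * h" using h l by simp
  have "(pi * l * h) * ((2 - 3 / 2 * h) / 4) \<le> (pi * l * h) * (1 / 2)"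
    using h by (intro mult_left_mono p) simp
  then show "emeasure lborel (strip a l n) \<le> ennreal (pi * l * (l / 2 ^ n) / 2)"
    unfolding emeasure_strip[OF l] h_def[symmetric] * by (intro ennreal_leI) simp
  have "(pi * l * h) * (1 / 8) \<le> (pi * l * h) * ((2 - 3 / 2 * h) / 4)"
    using h by (intro mult_left_mono p) simp
  then show "ennreal (pi * l * (l / 2 ^ n) / 8) \<le> emeasure lborel (strip a l n)"
    unfolding emeasure_strip[OF l] h_def[symmetric] * by (intro ennreal_leI) simp
qed

lemma sgn_strip:
  assumes "0 < l" "z \<in> strip a l n"
  obtains t where "a + l / 4 \<le> t" "t \<le> a + 3 * l / 4" "sgn z = cis (2 * pi * t)"
    "norm (sgn z) = 1" "z = of_real (norm z) * sgn z"
    "norm (sgn z - cis (2 * pi * (a + l / 2))) \<le> 2 * l"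
proof -
  have "sgn z \<in> arc (a + l / 4) (l / 2)" using assms by (simp add: strip_def)
  then obtain t where t: "a + l / 4 \<le> t" "t \<le> a + 3 * l / 4" "sgn z = cis (2 * pi * t)"
    by (force simp: arc_def)
  have "norm (sgn z - cis (2 * pi * (a + l / 2))) \<le> 2 * pi * \<bar>t - (a + l / 2)\<bar>"
    unfolding t by (rule norm_cis_diff_le)
  also have "\<dots> \<le> 2 * pi * (l / 4)" using t by (intro mult_left_mono) (auto simp: abs_if)
  also have "\<dots> \<le> 2 * l" using pi_less_4 assms by simp
  finally have "norm (sgn z - cis (2 * pi * (a + l / 2))) \<le> 2 * l" .
  moreover have "z = of_real (norm z) * sgn z" by (simp add: sgn_eq)
  ultimately show thesis using t by (intro that[of t]) (auto simp only: norm_cis)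
qed

text \<open>The projection \<open>sgn z\<close> has chord distance at least \<open>l\<close> from
  \<xi> and lies within \<open>3 * l\<close> of the arc point, which gives a factor 4. Replacing
  \<open>sgn z\<close> by \<open>z\<close> costs another factor 2.\<close>

lemma strip_far_arc:
  assumes l: "0 < l" "l \<le> 1" and z: "z \<in> strip a l n" and \<xi>: "norm \<xi> = 1" "\<xi> \<notin> arc a l"
  shows "norm (\<xi> - arc_point a l) \<le> 8 * norm (\<xi> - z)"
proof -
  define c where "c = cis (2 * pi * (a + l / 2))"
  obtain t where t: "a + l / 4 \<le> t" "t \<le> a + 3 * l / 4" "sgn z = cis (2 * pi * t)"
    "norm (sgn z) = 1" "z = of_real (norm z) * sgn z" "norm (sgn z - c) \<le> 2 * l"
    using sgn_strip[OF l(1) z] unfolding c_def by blast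
  obtain s where s: "a \<le> s" "s < a + 1" "\<xi> = cis (2 * pi * s)"
    using unit_circle_cis[OF \<xi>(1)] by blast
  then have "a + l < s" using \<xi>(2) l cis_in_arc_iff[of a s l] by auto
  then have far: "l \<le> norm (\<xi> - sgn z)"
    using norm_cis_diff_ge[of "l / 4" s t] s t l by simp
  have "z - sgn z = of_real (norm z - 1) * sgn z" using t(5) by (simp add: algebra_simps)
  then have "norm (z - sgn z) = \<bar>norm z - 1\<bar>" using t(4) by (simp add: norm_mult del: of_real_diff)
  also have "\<dots> = 1 - norm z" using strip_norm[OF l(1) z] by simp
  also have "\<dots> \<le> norm (\<xi> - z)" by (rule norm_diff_unit_ge[OF \<xi>(1)])
  finally have "norm (\<xi> - sgn z) \<le> 2 * norm (\<xi> - z)"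
    using norm_triangle_ineq[of "\<xi> - z" "z - sgn z"] by simp
  moreover have "c - arc_point a l = of_real l * c"
    using l by (simp add: arc_point_eq c_def algebra_simps)
  then have "norm (c - arc_point a l) = l" using l by (simp add: norm_mult c_def)
  then have "norm (\<xi> - arc_point a l) \<le> norm (\<xi> - sgn z) + 2 * l + l"
    using norm_triangle_ineq[of "\<xi> - sgn z" "sgn z - arc_point a l"]
      norm_triangle_ineq[of "sgn z - c" "c - arc_point a l"] t(6) by simp
  ultimately show ?thesis using far by simp
qed

section \<open>Integrals of u and 1/u over the strips\<close>

context clark_measure
begin

lemma borel_measurable_u: "u \<in> borel_measurable (restrict_space borel (ball 0 1))"
  by (rule borel_measurable_continuous_on_restrict[OF continuous_on_u])

text \<open>\<open>u\<close> is determined only on the disc, so measurability on the plane requires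
  cutting off to a subset of the disc.\<close>

lemma borel_measurable_u_indicator:
  assumes [measurable]: "S \<in> sets borel" "h \<in> borel_measurable borel" and "S \<subseteq> ball 0 1"
  shows "(\<lambda>z. ennreal (h (u z)) * indicator S z) \<in> borel_measurable borel"
proof -
  have "(\<lambda>z. ennreal (h (u z))) \<in> borel_measurable (restrict_space borel (ball 0 1))"
    using borel_measurable_u by measurable
  then have "(\<lambda>z. ennreal (h (u z)) * indicator (ball 0 1) z) \<in> borel_measurable borel"
    by (subst (asm) borel_measurable_restrict_space_iff_ennreal) auto
  then have "(\<lambda>z. ennreal (h (u z)) * indicator (ball 0 1) z * indicator S z) \<in> borel_measurable borel"
    by measurable
  also have "(\<lambda>z. ennreal (h (u z)) * indicator (ball 0 1) z * indicator S z) = (\<lambda>z. ennreal (h (u z)) * indicator S z)"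
    using assms(3) by (auto simp: indicator_def fun_eq_iff)
  finally show ?thesis .
qed

text \<open>By Fubini the Poisson kernel is integrated over the strip for each \<xi>. For \<xi> on
  the arc the strip is enlarged to its whole annulus, where the circular means are 1; for other
  \<xi> the kernel is compared with the one at the arc point.\<close>

lemma nn_integral_strip_u_le:
  assumes l: "0 < l" "l \<le> 1"
  shows "(\<integral>\<^sup>+z\<in>strip a l n. ennreal (u z) \<partial>lborel) \<le>
    ennreal (pi * (measure \<sigma> (arc a l) * (l / 2 ^ n) + 64 * (l / 2 ^ n)\<^sup>2 * u (arc_point a l)))"
proof -
  define h where "h = l / 2 ^ n"
  have h: "0 < h" "h \<le> 1" using dyadic_bounds[OF l] by (auto simp only: h_def)
  define zI where "zI = arc_point a l"
  have nI: "norm zI = 1 - l" "norm zI < 1" using norm_arc_point[OF l] l by (auto simp: zI_def)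
  interpret pair_sigma_finite lborel \<sigma> ..
  have [measurable]: "snd \<in> lborel \<Otimes>\<^sub>M \<sigma> \<rightarrow>\<^sub>M borel"
    using measurable_compose[OF measurable_snd measurable_ident_sigma] by simp
  let ?A = "{r. l / 2 ^ Suc n < 1 - r \<and> 1 - r \<le> l / 2 ^ n}"
  have "(\<integral>\<^sup>+z\<in>strip a l n. ennreal (u z) \<partial>lborel) =
     (\<integral>\<^sup>+z. (\<integral>\<^sup>+\<xi>. ennreal (poisson z \<xi>) * indicator (strip a l n) z \<partial>\<sigma>) \<partial>lborel)"
  proof (rule nn_integral_cong)
    fix z
    show "ennreal (u z) * indicator (strip a l n) z =
      (\<integral>\<^sup>+\<xi>. ennreal (poisson z \<xi>) * indicator (strip a l n) z \<partial>\<sigma>)"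
      using nn_integral_poisson[OF strip_norm[OF l(1), of z a n]]
      by (cases "z \<in> strip a l n") auto
  qed
  also have "\<dots> = (\<integral>\<^sup>+\<xi>. (\<integral>\<^sup>+z. ennreal (poisson z \<xi>) * indicator (strip a l n) z \<partial>lborel) \<partial>\<sigma>)"
    by (rule Fubini'[symmetric]) measurable
  also have "\<dots> \<le> (\<integral>\<^sup>+\<xi>. ennreal (pi * h) * indicator (arc a l) \<xi> + ennreal (64 * pi * h\<^sup>2) * ennreal (poisson zI \<xi>) \<partial>\<sigma>)"
  proof (rule nn_integral_mono)
    fix \<xi> assume "\<xi> \<in> space \<sigma>"
    then have \<xi>: "norm \<xi> = 1" by (simp add: space_sigma)
    show "(\<integral>\<^sup>+z. ennreal (poisson z \<xi>) * indicator (strip a l n) z \<partial>lborel) \<le>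
      ennreal (pi * h) * indicator (arc a l) \<xi> + ennreal (64 * pi * h\<^sup>2) * ennreal (poisson zI \<xi>)"
    proof (cases "\<xi> \<in> arc a l")
      case True
      have "(\<integral>\<^sup>+z. ennreal (poisson z \<xi>) * indicator (strip a l n) z \<partial>lborel) \<le>
         (\<integral>\<^sup>+z. indicator ?A (norm z) * ennreal (poisson z \<xi>) \<partial>lborel)"
        by (intro nn_integral_mono) (auto simp: strip_def indicator_def)
      also have "\<dots> = (\<integral>\<^sup>+z. indicator ?A (norm (z::complex)) \<partial>lborel)"
      proof (rule nn_integral_lborel_poisson[OF _ \<xi>])
        show "indicator ?A r = (0::ennreal)" if "1 \<le> r" for r
          using that dyadic_bounds(1)[OF l, of "Suc n"] by (simp only: indicator_def) simp
      qed measurable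
      also have "\<dots> = (\<integral>\<^sup>+z. indicator {z::complex. l / 2 ^ Suc n < 1 - norm z \<and> 1 - norm z \<le> l / 2 ^ n} z \<partial>lborel)"
        by (intro nn_integral_cong) (auto simp: indicator_def)
      also have "\<dots> = ennreal (pi * (h / 2 * (2 - 3 / 2 * h)))"
        using emeasure_lborel_dyadic_annulus[OF l, of n] by (simp add: h_def)
      also have "\<dots> \<le> ennreal (pi * (h / 2 * 2))"
        using h by (intro ennreal_leI mult_left_mono) auto
      finally show ?thesis using True by (simp add: add_increasing2)
    next
      case False
      have "(\<integral>\<^sup>+z. ennreal (poisson z \<xi>) * indicator (strip a l n) z \<partial>lborel) \<le>
         (\<integral>\<^sup>+z. ennreal (128 * h / l * poisson zI \<xi>) * indicator (strip a l n) z \<partial>lborel)"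
      proof (rule nn_integral_mono)
        fix z
        show "ennreal (poisson z \<xi>) * indicator (strip a l n) z \<le>
          ennreal (128 * h / l * poisson zI \<xi>) * indicator (strip a l n) z"
        proof (cases "z \<in> strip a l n")
          case z: True
          have nz: "norm z < 1" by (rule strip_norm[OF l(1) z])
          have P: "0 < poisson zI \<xi>" by (rule poisson_pos[OF nI(2) \<xi>])
          have "1 - norm z \<le> h" using z by (simp add: strip_def h_def)
          then have num: "1 - (norm z)\<^sup>2 \<le> 2 * h" using one_minus_norm_sq_le[of z] by simp
          have den: "l \<le> 1 - (norm zI)\<^sup>2" using one_minus_norm_sq_ge[OF nI(2)] nI by simp
          \<comment> \<open>The constant 128 is 64 from the squared ratio 8 of distances, times 2
            from the bound \<open>2 * h\<close> on the numerator; \<open>l\<close> bounds the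
            denominator from below.\<close>
          have "poisson z \<xi> \<le> 8\<^sup>2 * (1 - (norm z)\<^sup>2) / (1 - (norm zI)\<^sup>2) * poisson zI \<xi>"
            using strip_far_arc[OF l z \<xi> False] by (intro poisson_le_poisson nz nI(2) \<xi>) (simp add: zI_def)
          also have "\<dots> \<le> 8\<^sup>2 * (2 * h) / l * poisson zI \<xi>"
            using num den l h P norm_less_one_sq[OF nz] by (intro mult_right_mono frac_le mult_left_mono) auto
          finally show ?thesis using z by (simp add: ennreal_leI)
        qed simp
      qed
      also have "\<dots> = ennreal (128 * h / l * poisson zI \<xi>) * emeasure lborel (strip a l n)"
        by (rule nn_integral_cmult_indicator) measurable
      also have "\<dots> \<le> ennreal (128 * h / l * poisson zI \<xi>) * ennreal (pi * l * h / 2)"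
        unfolding h_def by (intro mult_left_mono emeasure_strip_bounds l) auto
      also have "\<dots> = ennreal (128 * h / l * poisson zI \<xi> * (pi * l * h / 2))"
        using h l poisson_pos[OF nI(2) \<xi>] by (intro ennreal_mult[symmetric]) auto
      also have "128 * h / l * poisson zI \<xi> * (pi * l * h / 2) = 64 * pi * h\<^sup>2 * poisson zI \<xi>"
        using l by (simp add: power2_eq_square)
      also have "ennreal \<dots> = ennreal (64 * pi * h\<^sup>2) * ennreal (poisson zI \<xi>)"
        by (rule ennreal_mult') simp
      finally show ?thesis using False by simp
    qed
  qed
  also have "\<dots> = ennreal (pi * h) * emeasure \<sigma> (arc a l) + ennreal (64 * pi * h\<^sup>2) * ennreal (u zI)"
    by (subst nn_integral_add) (auto simp: nn_integral_cmult nn_integral_poisson[OF nI(2)])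
  also have "\<dots> = ennreal (pi * h * measure \<sigma> (arc a l) + 64 * pi * h\<^sup>2 * u zI)"
    using h u_pos[OF nI(2)] by (simp add: emeasure_eq_measure ennreal_mult ennreal_plus)
  also have "pi * h * measure \<sigma> (arc a l) + 64 * pi * h\<^sup>2 * u zI = pi * (measure \<sigma> (arc a l) * h + 64 * h\<^sup>2 * u zI)"
    by (simp add: algebra_simps)
  finally show ?thesis by (simp add: h_def zI_def)
qed

text \<open>Integrates the inequality \<open>1 / u + u / b\<^sup>2 \<ge> 2 / b\<close> over the strip, with \<open>b\<close>
  comparable to the average of \<open>u\<close>.\<close>
lemma nn_integral_strip_inverse_ge:
  assumes l: "0 < l" "l \<le> 1" and small: "measure \<sigma> (arc a l) \<le> l / 2 ^ n * u (arc_point a l)"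
  shows "ennreal (pi * l\<^sup>2 / (4160 * u (arc_point a l))) \<le> (\<integral>\<^sup>+z\<in>strip a l n. ennreal (1 / u z) \<partial>lborel)"
proof -
  define h where "h = l / 2 ^ n"
  have h: "0 < h" "h \<le> 1" using dyadic_bounds[OF l] by (auto simp only: h_def)
  define v where "v = u (arc_point a l)"
  have v: "0 < v" using norm_arc_point[OF l] l by (auto simp: v_def intro: u_pos)
  \<comment> \<open>Chosen so that the term with \<open>u / b\<^sup>2\<close>, at most
    \<open>65 * pi * h\<^sup>2 * v / b\<^sup>2\<close>, is half of the lower bound
    \<open>(2 / b) * (pi * l * h / 8)\<close>. Here 65 = 1 + 64 collects the mass of the arc and the
    contribution of its complement.\<close>
  define b where "b = 520 * v * h / l"
  have b: "0 < b" using v h l by (simp add: b_def)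
  have sub: "strip a l n \<subseteq> ball 0 1" using strip_norm[OF l(1)] by auto
  have [measurable]: "(\<lambda>z. ennreal (u z) * indicator (strip a l n) z) \<in> borel_measurable borel"
    "(\<lambda>z. ennreal (1 / u z) * indicator (strip a l n) z) \<in> borel_measurable borel"
    using borel_measurable_u_indicator[of "strip a l n" "\<lambda>x. x"]
      borel_measurable_u_indicator[of "strip a l n" "\<lambda>x. 1 / x"] sub by auto
  let ?X = "\<integral>\<^sup>+z\<in>strip a l n. ennreal (1 / u z) \<partial>lborel"
  have "ennreal (pi * l\<^sup>2 / (2080 * v)) = ennreal (2 / b) * ennreal (pi * l * h / 8)"
    using b v l h by (simp add: ennreal_mult[symmetric] b_def power2_eq_square)
  also have "\<dots> \<le> ennreal (2 / b) * emeasure lborel (strip a l n)"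
    unfolding h_def by (intro mult_left_mono emeasure_strip_bounds l) auto
  also have "\<dots> = (\<integral>\<^sup>+z. ennreal (2 / b) * indicator (strip a l n) z \<partial>lborel)"
    by (rule nn_integral_cmult_indicator[symmetric]) measurable
  also have "\<dots> \<le> (\<integral>\<^sup>+z. ennreal (1 / u z) * indicator (strip a l n) z +
      ennreal (1 / b\<^sup>2) * (ennreal (u z) * indicator (strip a l n) z) \<partial>lborel)"
  proof (rule nn_integral_mono)
    fix z
    show "ennreal (2 / b) * indicator (strip a l n) z \<le> ennreal (1 / u z) * indicator (strip a l n) z +
      ennreal (1 / b\<^sup>2) * (ennreal (u z) * indicator (strip a l n) z)"
    proof (cases "z \<in> strip a l n")
      case True
      have uz: "0 < u z" using strip_norm[OF l(1) True] by (rule u_pos)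
      \<comment> \<open>Expanding this square gives the pointwise inequality to be
        integrated.\<close>
      have "0 \<le> (1 / u z) * (1 - u z / b)\<^sup>2" using uz by simp
      also have "\<dots> = 1 / u z + 1 / b\<^sup>2 * u z - 2 / b"
        using uz b by (simp add: field_simps power2_eq_square)
      finally have "ennreal (2 / b) \<le> ennreal (1 / u z + 1 / b\<^sup>2 * u z)" by (intro ennreal_leI) simp
      also have "\<dots> = ennreal (1 / u z) + ennreal (1 / b\<^sup>2) * ennreal (u z)"
        using uz by (simp add: ennreal_mult'[symmetric] ennreal_plus[symmetric] del: ennreal_plus)
      finally show ?thesis using True by simp
    qed simp
  qed
  also have "\<dots> = ?X + ennreal (1 / b\<^sup>2) * (\<integral>\<^sup>+z\<in>strip a l n. ennreal (u z) \<partial>lborel)"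
    by (subst nn_integral_add) (auto simp: nn_integral_cmult)
  also have "\<dots> \<le> ?X + ennreal (1 / b\<^sup>2) * ennreal (pi * 65 * h\<^sup>2 * v)"
  proof (intro add_left_mono mult_left_mono)
    have "measure \<sigma> (arc a l) * h \<le> h * v * h"
      using small h(1) unfolding h_def[symmetric] v_def[symmetric] by (intro mult_right_mono) auto
    then have "pi * (measure \<sigma> (arc a l) * h + 64 * h\<^sup>2 * v) \<le> pi * (h * v * h + 64 * h\<^sup>2 * v)"
      by (intro mult_left_mono add_right_mono) auto
    also have "\<dots> = pi * 65 * h\<^sup>2 * v" by (simp add: power2_eq_square algebra_simps)
    finally show "(\<integral>\<^sup>+z\<in>strip a l n. ennreal (u z) \<partial>lborel) \<le> ennreal (pi * 65 * h\<^sup>2 * v)"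
      using nn_integral_strip_u_le[OF l, of a n] unfolding h_def v_def
      by (meson ennreal_leI order_trans)
  qed auto
  also have "ennreal (1 / b\<^sup>2) * ennreal (pi * 65 * h\<^sup>2 * v) = ennreal (1 / b\<^sup>2 * (pi * 65 * h\<^sup>2 * v))"
    using v by (intro ennreal_mult[symmetric]) auto
  also have "1 / b\<^sup>2 * (pi * 65 * h\<^sup>2 * v) = pi * l\<^sup>2 / (4160 * v)"
    using v h l by (simp add: b_def power2_eq_square)
  finally have fin: "ennreal (pi * l\<^sup>2 / (2080 * v)) \<le> ?X + ennreal (pi * l\<^sup>2 / (4160 * v))" .
  \<comment> \<open>The estimate now reads \<open>2 y \<le> ?X + y\<close>, and the finite
    \<open>y\<close> may be cancelled.\<close>
  define y where "y = pi * l\<^sup>2 / (4160 * v)"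
  have y: "pi * l\<^sup>2 / (2080 * v) = y + y" "0 \<le> y" using v by (auto simp: y_def)
  have "ennreal y + ennreal y \<le> ennreal y + ?X"
    using fin y(2) unfolding y(1) y_def[symmetric] by (subst (asm) ennreal_plus) (auto simp: add.commute)
  then have "ennreal y \<le> ?X" by (simp add: ennreal_add_left_cancel_le)
  then show ?thesis by (simp add: y_def v_def)
qed

text \<open>The top strip lies at bounded hyperbolic distance from the arc point and has area
  comparable to \<open>l\<^sup>2\<close>, so Harnack's inequality suffices, without any hypothesis
  on the mass of the arc.\<close>

lemma nn_integral_top_strip_ge:
  assumes l: "0 < l" "l \<le> 1"
  shows "ennreal (pi * l\<^sup>2 * u (arc_point a l) / 512) \<le> (\<integral>\<^sup>+z\<in>strip a l 0. ennreal (u z) \<partial>lborel)"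
proof -
  define zI where "zI = arc_point a l"
  have nI: "norm zI = 1 - l" "norm zI < 1" using norm_arc_point[OF l] l by (auto simp: zI_def)
  have uI: "0 < u zI" by (rule u_pos[OF nI(2)])
  have le: "u zI / 64 \<le> u z" if z: "z \<in> strip a l 0" for z
  proof -
    define c where "c = cis (2 * pi * (a + l / 2))"
    obtain t where t: "z = of_real (norm z) * sgn z" "norm (sgn z - c) \<le> 2 * l"
      using sgn_strip[OF l(1) z] unfolding c_def by metis
    have nz: "norm z < 1" by (rule strip_norm[OF l(1) z])
    have z': "l / 2 < 1 - norm z" "1 - norm z \<le> l" using z by (auto simp: strip_def)
    \<comment> \<open>An angular displacement of at most \<open>2 * l\<close> plus a radial one of
      at most \<open>l\<close>; this is the constant 3 in Harnack's inequality.\<close>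
    have "z - zI = of_real (norm z) * (sgn z - c) + of_real (norm z - (1 - l)) * c"
      using t(1) l by (simp add: zI_def arc_point_eq c_def algebra_simps)
    then have "norm (z - zI) \<le> norm (of_real (norm z) * (sgn z - c)) + norm (of_real (norm z - (1 - l)) * c)"
      using norm_triangle_ineq by metis
    also have "\<dots> \<le> 1 * norm (sgn z - c) + \<bar>norm z - (1 - l)\<bar>"
      using nz by (auto simp: norm_mult c_def mult_left_le_one_le simp del: of_real_diff)
    also have "\<dots> \<le> 3 * (1 - norm zI)" using t(2) z' nI by simp
    finally have "u zI \<le> (1 + 3)\<^sup>2 * (1 - (norm zI)\<^sup>2) / (1 - (norm z)\<^sup>2) * u z"
      by (intro u_harnack nz nI(2)) auto
    \<comment> \<open>The constant 64 is 16 times \<open>2 * l\<close> divided by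
      \<open>l / 2\<close>.\<close>
    also have "\<dots> \<le> (1 + 3)\<^sup>2 * (2 * l) / (l / 2) * u z"
      using one_minus_norm_sq_le[of zI] one_minus_norm_sq_ge[OF nz] nI z' l u_pos[OF nz] norm_less_one_sq[OF nI(2)]
      by (intro mult_right_mono frac_le mult_left_mono) auto
    finally show ?thesis using l by simp
  qed
  have "ennreal (pi * l\<^sup>2 * u zI / 512) = ennreal (u zI / 64) * ennreal (pi * l * (l / 2 ^ 0) / 8)"
    using uI l by (simp add: ennreal_mult[symmetric] power2_eq_square)
  also have "\<dots> \<le> ennreal (u zI / 64) * emeasure lborel (strip a l 0)"
    by (intro mult_left_mono emeasure_strip_bounds l) auto
  also have "\<dots> = (\<integral>\<^sup>+z. ennreal (u zI / 64) * indicator (strip a l 0) z \<partial>lborel)"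
    by (rule nn_integral_cmult_indicator[symmetric]) measurable
  also have "\<dots> \<le> (\<integral>\<^sup>+z\<in>strip a l 0. ennreal (u z) \<partial>lborel)"
    using le by (intro nn_integral_mono) (auto simp: indicator_def ennreal_leI)
  finally show ?thesis by (simp add: zI_def)
qed

text \<open>Smallness of the mass at scale \<open>N\<close> implies it at every scale
  \<open>n < N\<close>, so \<open>N\<close> disjoint strips contribute equally to the integral of
  \<open>1 / u\<close>, while the top strip alone bounds the integral of \<open>u\<close> from
  below.\<close>

lemma B2_product_ge:
  assumes l: "0 < l" "l \<le> 1" and small: "measure \<sigma> (arc a l) \<le> l / 2 ^ N * u (arc_point a l)"
  shows "ennreal (N / 8519680) \<le> B2_const u"
proof -
  define v where "v = u (arc_point a l)"
  have v: "0 < v" using norm_arc_point[OF l] l by (auto simp: v_def intro: u_pos)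
  define Q where "Q = carleson_box (arc a l)"
  have Qb: "Q \<subseteq> ball 0 1" and [measurable]: "Q \<in> sets borel" by (auto simp: Q_def carleson_box_def)
  have SQ: "strip a l n \<subseteq> Q" for n unfolding Q_def by (rule strip_subset_carleson_box[OF l])
  have A: "ennreal (1 / (2 * l\<^sup>2)) \<le> ennreal (1 / measure area_meas Q)"
    unfolding Q_def measure_carleson_box[OF l] using l by (intro ennreal_leI divide_left_mono) auto
  have [measurable]: "(\<lambda>z. ennreal (1 / u z) * indicator Q z) \<in> borel_measurable borel"
    using borel_measurable_u_indicator[of Q "\<lambda>x. 1 / x"] Qb by auto
  have lift: "(\<integral>\<^sup>+z\<in>Q. ennreal (h (u z)) \<partial>area_meas) = ennreal (1 / pi) * (\<integral>\<^sup>+z\<in>Q. ennreal (h (u z)) \<partial>lborel)"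
    if [measurable]: "h \<in> borel_measurable borel" for h
    using borel_measurable_u Qb by (subst area_nn_integral) (auto simp: Int_absorb2)
  have "ennreal (l\<^sup>2 * v / 512) = ennreal (1 / pi) * ennreal (pi * l\<^sup>2 * v / 512)"
    using v by (simp add: ennreal_mult[symmetric])
  also have "\<dots> \<le> ennreal (1 / pi) * (\<integral>\<^sup>+z\<in>strip a l 0. ennreal (u z) \<partial>lborel)"
    unfolding v_def by (intro mult_left_mono nn_integral_top_strip_ge l) auto
  also have "\<dots> \<le> ennreal (1 / pi) * (\<integral>\<^sup>+z\<in>Q. ennreal (u z) \<partial>lborel)"
    using SQ[of 0] by (intro mult_left_mono nn_integral_mono) (auto simp: indicator_def)
  also have "\<dots> = (\<integral>\<^sup>+z\<in>Q. ennreal (u z) \<partial>area_meas)"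
    using lift[of "\<lambda>x. x"] by simp
  finally have I1: "ennreal (l\<^sup>2 * v / 512) \<le> (\<integral>\<^sup>+z\<in>Q. ennreal (u z) \<partial>area_meas)" .
  \<comment> \<open>The integral of \<open>1 / u\<close> as a measure, so that the contributions of
    the disjoint strips add up by additivity.\<close>
  define M where "M = density lborel (\<lambda>z. ennreal (1 / u z) * indicator Q z)"
  have M: "emeasure M S = (\<integral>\<^sup>+z\<in>S. ennreal (1 / u z) \<partial>lborel)" if [measurable]: "S \<in> sets borel" and "S \<subseteq> Q" for S
  proof -
    have "emeasure M S = (\<integral>\<^sup>+z\<in>S. (ennreal (1 / u z) * indicator Q z) \<partial>lborel)"
      unfolding M_def by (rule emeasure_density) auto
    also have "\<dots> = (\<integral>\<^sup>+z\<in>S. ennreal (1 / u z) \<partial>lborel)"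
      using that(2) by (intro nn_integral_cong) (auto simp: indicator_def)
    finally show ?thesis .
  qed
  have "ennreal (N * l\<^sup>2 / (4160 * v)) = ennreal (1 / pi) * (\<Sum>n<N. ennreal (pi * l\<^sup>2 / (4160 * v)))"
    using v by (simp add: ennreal_mult[symmetric] ennreal_of_nat_eq_real_of_nat)
  also have "\<dots> \<le> ennreal (1 / pi) * (\<Sum>n<N. emeasure M (strip a l n))"
  proof (intro mult_left_mono sum_mono)
    fix n assume "n \<in> {..<N}"
    then have "l / 2 ^ N * v \<le> l / 2 ^ n * v"
      using l v by (intro mult_right_mono divide_left_mono power_increasing) auto
    then have "measure \<sigma> (arc a l) \<le> l / 2 ^ n * u (arc_point a l)" using small by (simp add: v_def)
    from nn_integral_strip_inverse_ge[OF l this]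
    show "ennreal (pi * l\<^sup>2 / (4160 * v)) \<le> emeasure M (strip a l n)"
      by (subst M) (auto simp: v_def SQ)
  qed auto
  also have "(\<Sum>n<N. emeasure M (strip a l n)) = emeasure M (\<Union>n<N. strip a l n)"
    using disjoint_strips[OF l(1), of a]
    by (intro sum_emeasure) (auto simp: M_def disjoint_family_on_def)
  also have "\<dots> \<le> emeasure M Q" using SQ by (intro emeasure_mono) (auto simp: M_def)
  also have "emeasure M Q = (\<integral>\<^sup>+z\<in>Q. ennreal (1 / u z) \<partial>lborel)" by (rule M) auto
  also have "ennreal (1 / pi) * \<dots> = (\<integral>\<^sup>+z\<in>Q. ennreal (1 / u z) \<partial>area_meas)"
    using lift[of "\<lambda>x. 1 / x"] by simp
  finally have I2: "ennreal (N * l\<^sup>2 / (4160 * v)) \<le> (\<integral>\<^sup>+z\<in>Q. ennreal (1 / u z) \<partial>area_meas)"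
    by (simp add: mult_left_mono)
  \<comment> \<open>8519680 = 2 * 2 * 512 * 4160: two area factors and the constants of the two
    integral estimates; \<open>l\<close> and \<open>v\<close> cancel.\<close>
  have "ennreal (N / 8519680) = (ennreal (1 / (2 * l\<^sup>2)) * ennreal (l\<^sup>2 * v / 512)) *
      (ennreal (1 / (2 * l\<^sup>2)) * ennreal (N * l\<^sup>2 / (4160 * v)))"
    using v l by (simp add: ennreal_mult[symmetric] divide_simps)
  also have "\<dots> \<le> (ennreal (1 / measure area_meas Q) * (\<integral>\<^sup>+z\<in>Q. ennreal (u z) \<partial>area_meas)) *
      (ennreal (1 / measure area_meas Q) * (\<integral>\<^sup>+z\<in>Q. ennreal (1 / u z) \<partial>area_meas))"
    by (intro mult_mono A I1 I2) auto
  also have "\<dots> \<le> B2_const u"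
    unfolding B2_const_def Q_def by (rule SUP_upper2[of "(a, l)"]) (use l in auto)
  finally show ?thesis .
qed

text \<open>With \<open>N\<close> above 8519680 times the finite weight constant, an arc violating
  the bound for \<open>c = 1 / 2 ^ N\<close> would contradict the product estimate.\<close>

lemma B2_weight_imp_arc_bound:
  assumes "B2_weight u"
  shows "\<exists>c>0. \<forall>a l. 0 < l \<and> l \<le> 1 \<longrightarrow> c * u (arc_point a l) \<le> measure \<sigma> (arc a l) / arc_len (arc a l)"
proof -
  obtain B where B: "B2_const u = ennreal B" "0 \<le> B"
    using assms unfolding B2_weight_def by (cases "B2_const u") auto
  obtain N :: nat where N: "B * 8519680 < N" using reals_Archimedean2 by blast
  have "1 / 2 ^ N * u (arc_point a l) \<le> measure \<sigma> (arc a l) / arc_len (arc a l)"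
    if l: "0 < l" "l \<le> 1" for a l
  proof (rule ccontr)
    assume "\<not> ?thesis"
    then have "measure \<sigma> (arc a l) \<le> l / 2 ^ N * u (arc_point a l)"
      using l by (simp add: arc_len_arc field_simps)
    from B2_product_ge[OF l this] have "N / 8519680 \<le> B" using B by simp
    then show False using N by simp
  qed
  then show ?thesis by (intro exI[of _ "1 / 2 ^ N"]) auto
qed

end

section \<open>The arc bound implies contractivity\<close>

lemma Re_mult_integral:
  fixes K :: "'a \<Rightarrow> complex"
  assumes "integrable M K"
  shows "Re (p * (\<integral>x. K x \<partial>M)) = (\<integral>x. Re (p * K x) \<partial>M)"
proof -
  have "integrable M (\<lambda>x. p * K x)" using assms by (rule integrable_mult_right)
  then have "(\<integral>x. Re (p * K x) \<partial>M) = Re (\<integral>x. p * K x \<partial>M)" by (rule integral_Re)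
  also have "(\<integral>x. p * K x \<partial>M) = p * (\<integral>x. K x \<partial>M)" by (rule integral_mult_right_zero)
  finally show ?thesis ..
qed

context clark_measure
begin

lemma borel_measurable_sigma:
  assumes "h \<in> borel_measurable borel"
  shows "h \<in> borel_measurable \<sigma>"
  using measurable_compose[OF measurable_ident_sigma assms] by simp

text \<open>The integrand is the derivative of the Herglotz kernel. The measure represents only the
  real part \<open>u\<close> of the transform, so the real derivative of \<open>u\<close> is
  computed from both representations and compared.\<close>

lemma deriv_herglotz_eq_integral:
  assumes z: "norm z < 1"
  shows "integrable \<sigma> (\<lambda>\<xi>. 2 * \<xi> / (\<xi> - z)\<^sup>2)"
    and "(\<integral>\<xi>. 2 * \<xi> / (\<xi> - z)\<^sup>2 \<partial>\<sigma>) = 2 * \<alpha> * deriv f z / (\<alpha> - f z)\<^sup>2"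
proof -
  define d where "d = 1 - norm z"
  have d: "0 < d" using z by (simp add: d_def)
  have dist1: "d \<le> norm (\<xi> - z)" if "norm \<xi> = 1" for \<xi>
    using norm_diff_unit_ge[OF that, of z] by (simp add: d_def)
  let ?K = "\<lambda>\<xi>. 2 * \<xi> / (\<xi> - z)\<^sup>2"
  show int: "integrable \<sigma> ?K"
  proof (rule integrable_bounded)
    show "?K \<in> borel_measurable \<sigma>" by (rule borel_measurable_sigma) measurable
    show "norm (?K \<xi>) \<le> 2 / d\<^sup>2" if "norm \<xi> = 1" for \<xi>
    proof -
      have "d\<^sup>2 \<le> (norm (\<xi> - z))\<^sup>2" using dist1[OF that] d by (intro power_mono) auto
      then show ?thesis using that d by (simp add: norm_divide norm_mult norm_power frac_le)
    qed
  qed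
  define T where "T = (\<integral>\<xi>. ?K \<xi> \<partial>\<sigma>)"
  define m where "m = measure \<sigma> (space \<sigma>)"
  \<comment> \<open>Second-order Taylor remainder of the Herglotz kernel, integrated over \<sigma>.
    Staying within \<open>d / 2\<close> of \<open>z\<close> keeps \<open>w\<close> at distance at
    least \<open>d / 2\<close> from the circle, whence
    \<open>2 / (d / 2 * d\<^sup>2) = 4 / d ^ 3\<close>.\<close>
  have bound: "\<bar>u w - u z - Re ((w - z) * T)\<bar> \<le> 4 / d ^ 3 * m * (norm (w - z))\<^sup>2"
    if w: "norm (w - z) < d / 2" for w
  proof -
    have nw: "norm w < 1" using w norm_triangle_ineq2[of w z] d by (simp add: d_def)
    have dist2: "d / 2 \<le> norm (\<xi> - w)" if "norm \<xi> = 1" for \<xi>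
      using dist1[OF that] w norm_triangle_ineq[of "\<xi> - w" "w - z"] by simp
    have pw: "\<bar>poisson w \<xi> - poisson z \<xi> - Re ((w - z) * ?K \<xi>)\<bar> \<le> 4 / d ^ 3 * (norm (w - z))\<^sup>2"
      if \<xi>: "norm \<xi> = 1" for \<xi>
    proof -
      have ne: "\<xi> - w \<noteq> 0" "\<xi> - z \<noteq> 0" using dist1[OF \<xi>] dist2[OF \<xi>] d by auto
      have "(\<xi> + w) / (\<xi> - w) - (\<xi> + z) / (\<xi> - z) - (w - z) * ?K \<xi>
        = 2 * \<xi> * (w - z)\<^sup>2 / ((\<xi> - w) * (\<xi> - z)\<^sup>2)"
        using ne by (simp add: divide_simps) (simp add: power2_eq_square algebra_simps)
      then have "poisson w \<xi> - poisson z \<xi> - Re ((w - z) * ?K \<xi>)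
         = Re (2 * \<xi> * (w - z)\<^sup>2 / ((\<xi> - w) * (\<xi> - z)\<^sup>2))"
        unfolding poisson_eq_Re[OF \<xi>] by (metis minus_complex.sel(1))
      also have "\<bar>\<dots>\<bar> \<le> norm (2 * \<xi> * (w - z)\<^sup>2 / ((\<xi> - w) * (\<xi> - z)\<^sup>2))"
        by (rule abs_Re_le_cmod)
      also have "\<dots> = 2 * (norm (w - z))\<^sup>2 / (norm (\<xi> - w) * (norm (\<xi> - z))\<^sup>2)"
        using \<xi> by (simp add: norm_divide norm_mult norm_power)
      also have "\<dots> \<le> 2 * (norm (w - z))\<^sup>2 / (d / 2 * d\<^sup>2)"
        using dist1[OF \<xi>] dist2[OF \<xi>] d by (intro divide_left_mono mult_mono power_mono mult_pos_pos) auto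
      also have "\<dots> = 4 / d ^ 3 * (norm (w - z))\<^sup>2"
        by (simp add: power3_eq_cube power2_eq_square)
      finally show ?thesis .
    qed
    have i3: "integrable \<sigma> (\<lambda>\<xi>. Re ((w - z) * ?K \<xi>))"
      using int by (intro integrable_Re integrable_mult_right) auto
    have "u w - u z - Re ((w - z) * T) = (\<integral>\<xi>. poisson w \<xi> - poisson z \<xi> - Re ((w - z) * ?K \<xi>) \<partial>\<sigma>)"
    proof -
      have "Re ((w - z) * T) = (\<integral>\<xi>. Re ((w - z) * ?K \<xi>) \<partial>\<sigma>)"
        unfolding T_def by (rule Re_mult_integral[OF int])
      then show ?thesis
        using integrable_poisson[OF nw] integrable_poisson[OF z] i3 u[of w] u[of z] nw z
        by (simp add: Bochner_Integration.integral_diff)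
    qed
    also have "\<bar>\<dots>\<bar> \<le> (\<integral>\<xi>. 4 / d ^ 3 * (norm (w - z))\<^sup>2 \<partial>\<sigma>)"
    proof (rule integral_abs_bound_integral)
      show "integrable \<sigma> (\<lambda>\<xi>. poisson w \<xi> - poisson z \<xi> - Re ((w - z) * ?K \<xi>))"
        using integrable_poisson[OF nw] integrable_poisson[OF z] i3 by auto
    qed (use pw in \<open>auto simp: space_sigma\<close>)
    finally show ?thesis by (simp add: m_def mult_ac)
  qed
  have "(u has_derivative (\<lambda>h. Re (h * T))) (at z)"
  proof (rule has_derivativeI_sandwich[where e = "d / 2" and H = "\<lambda>w. 4 / d ^ 3 * m * norm (w - z)"])
    show "bounded_linear (\<lambda>h. Re (h * T))"
      by (intro bounded_linear_compose[OF bounded_linear_Re] bounded_linear_mult_left)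
    show "((\<lambda>w. 4 / d ^ 3 * m * norm (w - z)) \<longlongrightarrow> 0) (at z)"
      using d by (auto intro!: tendsto_eq_intros)
    show "norm (u w - u z - Re ((w - z) * T)) / norm (w - z) \<le> 4 / d ^ 3 * m * norm (w - z)"
      if "w \<noteq> z" "dist w z < d / 2" for w
      using bound[of w] that by (simp add: dist_norm pos_divide_le_eq power2_eq_square mult.assoc)
  qed (use d in auto)
  moreover have "(u has_derivative (\<lambda>h. Re ((2 * \<alpha> * deriv f z / (\<alpha> - f z)\<^sup>2) * h))) (at z)"
  proof (rule has_derivative_transform_within_open[where s = "ball 0 1"])
    show "((\<lambda>z. Re ((\<alpha> + f z) / (\<alpha> - f z))) has_derivative
       (\<lambda>h. Re ((2 * \<alpha> * deriv f z / (\<alpha> - f z)\<^sup>2) * h))) (at z)"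
      using herglotz_deriv[OF z] unfolding has_field_derivative_def
      by (rule bounded_linear.has_derivative[OF bounded_linear_Re])
  qed (use z u_eq_Re in auto)
  ultimately have eq: "(\<lambda>h. Re (h * T)) = (\<lambda>h. Re ((2 * \<alpha> * deriv f z / (\<alpha> - f z)\<^sup>2) * h))"
    by (rule has_derivative_unique)
  \<comment> \<open>A complex-linear map is determined by its real part: the directions 1 and
    \<open>\<i>\<close> yield the real and imaginary parts of \<open>T\<close>.\<close>
  have "T = y" if "(\<lambda>h. Re (h * T)) = (\<lambda>h. Re (y * h))" for y
    using fun_cong[OF that, of 1] fun_cong[OF that, of \<i>] by (simp add: complex_eq_iff)
  from this[OF eq] show "T = 2 * \<alpha> * deriv f z / (\<alpha> - f z)\<^sup>2" .
qed

text \<open>Supplies the arcs that carry a fixed share of the mass seen from \<open>z\<close>: the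
  point of each such arc is at bounded hyperbolic distance from \<open>z\<close>, so Harnack's
  inequality replaces its value of \<open>u\<close> by \<open>u z\<close>. The window for
  \<open>b\<close> leaves room for two disjoint arcs.\<close>

lemma arc_bound_near_point:
  assumes c: "\<And>a l. 0 < l \<and> l \<le> 1 \<Longrightarrow> c * u (arc_point a l) \<le> measure \<sigma> (arc a l) / arc_len (arc a l)"
    and c0: "0 < c" and l: "0 < l" "l \<le> 1" and b: "t \<le> b" "b \<le> t + l / 4"
    and z: "z = of_real (1 - l) * cis (2 * pi * t)"
  shows "c * l * u z / 3200 \<le> measure \<sigma> (arc b (l / 8))"
    and "\<xi> \<in> arc b (l / 8) \<Longrightarrow> norm (\<xi> - z) \<le> 4 * l"
proof -
  have nz: "norm z = 1 - l" "norm z < 1" using l by (auto simp: z norm_mult simp del: of_real_diff)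
  define w where "w = arc_point b (l / 8)"
  have l8: "0 < l / 8" "l / 8 \<le> 1" using l by auto
  have nw: "norm w = 1 - l / 8" "norm w < 1" using norm_arc_point[OF l8] l by (auto simp: w_def)
  define e where "e = cis (2 * pi * (b + l / 16))"
  have "norm (e - cis (2 * pi * t)) \<le> 2 * pi * \<bar>b + l / 16 - t\<bar>"
    unfolding e_def by (rule norm_cis_diff_le)
  also have "\<dots> \<le> 2 * pi * (5 / 16 * l)" using b l by (intro mult_left_mono) auto
  also have "\<dots> \<le> 5 / 2 * l" using pi_less_4 l by simp
  finally have e: "norm (e - cis (2 * pi * t)) \<le> 5 / 2 * l" .
  have "w - z = of_real (1 - l) * (e - cis (2 * pi * t)) + of_real (7 / 8 * l) * e"
    using l8 by (simp add: w_def arc_point_eq z e_def algebra_simps)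
  then have "norm (w - z) \<le> norm (of_real (1 - l) * (e - cis (2 * pi * t))) + norm (of_real (7 / 8 * l) * e)"
    using norm_triangle_ineq by metis
  also have "\<dots> = (1 - l) * norm (e - cis (2 * pi * t)) + 7 / 8 * l"
    using l by (simp add: norm_mult e_def del: of_real_diff)
  also have "\<dots> \<le> 1 * norm (e - cis (2 * pi * t)) + 7 / 8 * l"
    using l by (intro add_right_mono mult_right_mono) auto
  also have "\<dots> \<le> 4 * (1 - norm z)" using e l nz by simp
  finally have "u z \<le> (1 + 4)\<^sup>2 * (1 - (norm z)\<^sup>2) / (1 - (norm w)\<^sup>2) * u w"
    by (intro u_harnack nz nw) auto
  also have "\<dots> \<le> (1 + 4)\<^sup>2 * (2 * l) / (l / 8) * u w"
    using one_minus_norm_sq_le[of z] one_minus_norm_sq_ge[OF nw(2)] nz nw l u_pos[OF nw(2)] norm_less_one_sq[OF nz(2)]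
    by (intro mult_right_mono frac_le mult_left_mono) auto
  \<comment> \<open>400 = 25 * 16, from \<open>(1 + 4)\<^sup>2\<close> and the ratio of
    \<open>2 * l\<close> to \<open>l / 8\<close>. The length \<open>l / 8\<close> of the arc then
    turns it into 3200.\<close>
  finally have "u z \<le> 400 * u w" using l by simp
  then have "c * l * u z \<le> c * l * (400 * u w)" using c0 l by (intro mult_left_mono) auto
  moreover have "c * u w \<le> measure \<sigma> (arc b (l / 8)) / (l / 8)"
    using c[of "l / 8" b] l8 by (simp add: w_def arc_len_arc)
  then have "c * u w * l \<le> 8 * measure \<sigma> (arc b (l / 8))" using l by (simp add: field_simps)
  ultimately show "c * l * u z / 3200 \<le> measure \<sigma> (arc b (l / 8))" by (simp add: mult_ac)
  assume "\<xi> \<in> arc b (l / 8)"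
  then obtain s where s: "b \<le> s" "s \<le> b + l / 8" "\<xi> = cis (2 * pi * s)" by (auto simp: arc_def)
  have "norm (\<xi> - cis (2 * pi * t)) \<le> 2 * pi * \<bar>s - t\<bar>" unfolding s by (rule norm_cis_diff_le)
  also have "\<dots> \<le> 2 * pi * (3 / 8 * l)" using b s by (intro mult_left_mono) auto
  also have "\<dots> \<le> 3 * l" using pi_less_4 l by simp
  finally have "norm (\<xi> - cis (2 * pi * t)) \<le> 3 * l" .
  moreover have "cis (2 * pi * t) - z = of_real l * cis (2 * pi * t)" by (simp add: z algebra_simps)
  then have "norm (cis (2 * pi * t) - z) = l" using l by (simp add: norm_mult)
  ultimately show "norm (\<xi> - z) \<le> 4 * l"
    using norm_triangle_ineq[of "\<xi> - cis (2 * pi * t)" "cis (2 * pi * t) - z"] by simp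
qed

text \<open>With respect to the probability measure \<open>poisson z \<cdot> \<sigma> / u z\<close>, the hyperbolic derivative is the
  modulus of the mean of a unimodular function; two arcs of comparable mass on which that function takes
  separated values keep the mean away from the unit circle.\<close>
lemma arc_bound_imp_hyp_deriv_le:
  assumes c: "\<And>a l. 0 < l \<and> l \<le> 1 \<Longrightarrow> c * u (arc_point a l) \<le> measure \<sigma> (arc a l) / arc_len (arc a l)"
    and c0: "0 < c" and z: "norm z < 1"
  shows "hyp_deriv f z \<le> 1 - c / 419430400"
proof -
  define l where "l = 1 - norm z"
  have l: "0 < l" "l \<le> 1" using z by (auto simp: l_def)
  define t where "t = Arg z / (2 * pi)"
  have zt: "z = of_real (1 - l) * cis (2 * pi * t)"
    using rcis_cmod_Arg[of z] by (simp add: t_def l_def rcis_def)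
  define T where "T = (\<integral>\<xi>. 2 * \<xi> / (\<xi> - z)\<^sup>2 \<partial>\<sigma>)"
  have int: "integrable \<sigma> (\<lambda>\<xi>. 2 * \<xi> / (\<xi> - z)\<^sup>2)" by (rule deriv_herglotz_eq_integral[OF z])
  \<comment> \<open>A rotation making the integral \<open>T\<close> real and nonnegative, so that
    its modulus is the integral of a real part.\<close>
  obtain q where q: "norm q = 1" "q * T = of_real (norm T)"
  proof (cases "T = 0")
    case False
    have "cnj (sgn T) * T = T * cnj T / of_real (norm T)" by (simp add: sgn_eq)
    also have "\<dots> = of_real (norm T)"
      unfolding complex_norm_square[symmetric] using False by (simp add: power2_eq_square)
    finally show thesis using that[of "cnj (sgn T)"] False by (simp add: norm_sgn)
  qed (use that[of 1] in auto)
  \<comment> \<open>The phase of the rotated kernel: on the circle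
    \<open>1 - \<xi> * cnj z = \<xi> * cnj (\<xi> - z)\<close>, hence \<psi> is unimodular there. As
    a function of \<xi> it is a Moebius map, which makes its differences explicit.\<close>
  define \<psi> where "\<psi> \<xi> = q * (1 - \<xi> * cnj z) / (\<xi> - z)" for \<xi>
  have ne: "\<xi> - z \<noteq> 0" if "norm \<xi> = 1" for \<xi> using that z by auto
  have xi1: "\<xi> * cnj \<xi> = 1" if "norm \<xi> = 1" for \<xi> using that complex_norm_square[of \<xi>] by simp
  have num: "1 - \<xi> * cnj z = \<xi> * cnj (\<xi> - z)" if "norm \<xi> = 1" for \<xi>
    using xi1[OF that] by (simp add: algebra_simps)
  have psi1: "norm (\<psi> \<xi>) = 1" if "norm \<xi> = 1" for \<xi>
  proof -
    have "norm (1 - \<xi> * cnj z) = norm (\<xi> - z)"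
      unfolding num[OF that] using that by (simp add: norm_mult del: complex_cnj_diff)
    then show ?thesis using q ne[OF that] by (simp add: \<psi>_def norm_divide norm_mult)
  qed
  have kernel: "poisson z \<xi> * Re (\<psi> \<xi>) = (1 - (norm z)\<^sup>2) / 2 * Re (q * (2 * \<xi> / (\<xi> - z)\<^sup>2))"
    if "norm \<xi> = 1" for \<xi>
  proof -
    have "q * (2 * \<xi> / (\<xi> - z)\<^sup>2) = of_real (2 / (norm (\<xi> - z))\<^sup>2) * \<psi> \<xi>"
      unfolding \<psi>_def num[OF that] of_real_divide complex_norm_square
      using ne[OF that] by (simp add: power2_eq_square del: complex_cnj_diff)
    then have "Re (q * (2 * \<xi> / (\<xi> - z)\<^sup>2)) = 2 / (norm (\<xi> - z))\<^sup>2 * Re (\<psi> \<xi>)"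
      by (simp only: Re_complex_of_real Im_complex_of_real times_complex.sel(1))
    then show ?thesis by (simp add: poisson_def)
  qed
  have iRe: "integrable \<sigma> (\<lambda>\<xi>. (1 - (norm z)\<^sup>2) / 2 * Re (q * (2 * \<xi> / (\<xi> - z)\<^sup>2)))"
    using int by (intro integrable_mult_right integrable_Re) auto
  have uD: "u z * hyp_deriv f z = (\<integral>\<xi>. (1 - (norm z)\<^sup>2) / 2 * Re (q * (2 * \<xi> / (\<xi> - z)\<^sup>2)) \<partial>\<sigma>)"
  proof -
    have "2 * u z * hyp_deriv f z = (1 - (norm z)\<^sup>2) * norm T"
      using norm_herglotz_deriv[OF z] deriv_herglotz_eq_integral(2)[OF z] by (simp add: T_def)
    moreover have "norm T = Re (q * T)" using q by simp
    moreover have "Re (q * T) = (\<integral>\<xi>. Re (q * (2 * \<xi> / (\<xi> - z)\<^sup>2)) \<partial>\<sigma>)"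
      unfolding T_def by (rule Re_mult_integral[OF int])
    ultimately show ?thesis by simp
  qed
  \<comment> \<open>The density of the deficit \<open>u z * (1 - hyp_deriv f z)\<close>.
    Unimodularity of \<psi> rewrites it as a Poisson kernel times half the squared distance from
    \<psi> to 1, hence nonnegative.\<close>
  define D where "D \<xi> = poisson z \<xi> - (1 - (norm z)\<^sup>2) / 2 * Re (q * (2 * \<xi> / (\<xi> - z)\<^sup>2))" for \<xi>
  have iD: "integrable \<sigma> D" unfolding D_def using integrable_poisson[OF z] iRe by auto
  have uD': "u z - u z * hyp_deriv f z = (\<integral>\<xi>. D \<xi> \<partial>\<sigma>)"
    unfolding D_def uD using integrable_poisson[OF z] iRe u[of z] z by simp
  have D: "D \<xi> = poisson z \<xi> * ((norm (1 - \<psi> \<xi>))\<^sup>2 / 2)" if "norm \<xi> = 1" for \<xi>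
  proof -
    have "(Re (\<psi> \<xi>))\<^sup>2 + (Im (\<psi> \<xi>))\<^sup>2 = 1" using psi1[OF that] by (metis cmod_power2 one_power2)
    then have "(norm (1 - \<psi> \<xi>))\<^sup>2 = 2 * (1 - Re (\<psi> \<xi>))"
      unfolding cmod_power2 by (simp add: power2_eq_square algebra_simps)
    then show ?thesis using kernel[OF that] by (simp add: D_def right_diff_distrib)
  qed
  \<comment> \<open>Two arcs of length \<open>l / 8\<close> separated by a gap of length
    \<open>l / 8\<close>.\<close>
  let ?J1 = "arc t (l / 8)" and ?J2 = "arc (t + l / 4) (l / 8)"
  have near: "norm (\<xi> - z) \<le> 4 * l" if "\<xi> \<in> ?J1 \<union> ?J2" for \<xi>
    using arc_bound_near_point(2)[OF c c0 l _ _ zt, of t \<xi>] arc_bound_near_point(2)[OF c c0 l _ _ zt, of "t + l / 4" \<xi>]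
      that l by auto
  have J: "norm \<xi> = 1" if "\<xi> \<in> ?J1 \<union> ?J2" for \<xi>
    using that by (auto simp: arc_def)
  have sep: "1 / 32 \<le> norm (\<psi> \<xi> - \<psi> \<eta>)" if \<xi>: "\<xi> \<in> ?J1" and \<eta>: "\<eta> \<in> ?J2" for \<xi> \<eta>
  proof -
    obtain s where s: "t \<le> s" "s \<le> t + l / 8" "\<xi> = cis (2 * pi * s)" using \<xi> by (auto simp: arc_def)
    obtain r where r: "t + l / 4 \<le> r" "r \<le> t + l / 4 + l / 8" "\<eta> = cis (2 * pi * r)" using \<eta> by (auto simp: arc_def)
    have ch: "l / 2 \<le> norm (\<eta> - \<xi>)"
      using norm_cis_diff_ge[of "l / 8" r s] r s l by simp
    have n: "norm \<xi> = 1" "norm \<eta> = 1" using J \<xi> \<eta> by auto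
    have zz: "z * cnj z = of_real ((norm z)\<^sup>2)" by (rule complex_norm_square[symmetric])
    \<comment> \<open>The numerator of a difference of two values of a Moebius map factors; with
      chord at least \<open>l / 2\<close>, \<open>1 - (norm z)\<^sup>2 \<ge> l\<close> and both
      distances at most \<open>4 * l\<close> this gives 1/32.\<close>
    have "(1 - \<xi> * cnj z) * (\<eta> - z) - (1 - \<eta> * cnj z) * (\<xi> - z) = (\<eta> - \<xi>) * (1 - z * cnj z)"
      by (simp add: algebra_simps)
    then have "\<psi> \<xi> - \<psi> \<eta> = q * ((\<eta> - \<xi>) * of_real (1 - (norm z)\<^sup>2)) / ((\<xi> - z) * (\<eta> - z))"
      using ne[OF n(1)] ne[OF n(2)] unfolding \<psi>_def zz
      by (simp add: diff_frac_eq) (simp add: mult_ac flip: right_diff_distrib)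
    then have eq: "norm (\<psi> \<xi> - \<psi> \<eta>) = norm (\<eta> - \<xi>) * (1 - (norm z)\<^sup>2) / (norm (\<xi> - z) * norm (\<eta> - z))"
      using q norm_less_one_sq[OF z] by (simp add: norm_mult norm_divide del: of_real_diff)
    have "1 / 32 = (l / 2) * l / (4 * l * (4 * l))" using l by simp
    also have "\<dots> \<le> norm (\<eta> - \<xi>) * (1 - (norm z)\<^sup>2) / (norm (\<xi> - z) * norm (\<eta> - z))"
      using ch one_minus_norm_sq_ge[OF z] near[of \<xi>] near[of \<eta>] \<xi> \<eta> l ne[OF n(1)] ne[OF n(2)]
      by (intro frac_le mult_mono mult_pos_pos) (auto simp: l_def)
    finally show ?thesis by (simp add: eq)
  qed
  \<comment> \<open>Values 1/32 apart cannot both be within 1/64 of 1, so on one whole arc \<psi>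
    stays away from 1.\<close>
  have "(\<forall>\<xi>\<in>?J1. 1 / 64 \<le> norm (1 - \<psi> \<xi>)) \<or> (\<forall>\<xi>\<in>?J2. 1 / 64 \<le> norm (1 - \<psi> \<xi>))"
  proof (rule ccontr)
    assume "\<not> ?thesis"
    then obtain \<xi> \<eta> where *: "\<xi> \<in> ?J1" "\<eta> \<in> ?J2" "norm (1 - \<psi> \<xi>) < 1 / 64" "norm (1 - \<psi> \<eta>) < 1 / 64"
      by (auto simp: not_le)
    have "norm (\<psi> \<xi> - \<psi> \<eta>) \<le> norm (1 - \<psi> \<eta>) + norm (1 - \<psi> \<xi>)"
      using norm_triangle_ineq4[of "1 - \<psi> \<eta>" "1 - \<psi> \<xi>"] by simp
    then show False using sep[OF *(1,2)] * by simp
  qed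
  then obtain b where b: "b = t \<or> b = t + l / 4" "\<And>\<xi>. \<xi> \<in> arc b (l / 8) \<Longrightarrow> 1 / 64 \<le> norm (1 - \<psi> \<xi>)"
    by blast
  have sJ: "c * l * u z / 3200 \<le> measure \<sigma> (arc b (l / 8))"
    using arc_bound_near_point(1)[OF c c0 l _ _ zt, of b] b(1) l by auto
  \<comment> \<open>On the chosen arc the Poisson kernel is at least \<open>1 / (16 * l)\<close> and
    half the squared distance at least \<open>(1 / 64)\<^sup>2 / 2 = 1 / 8192\<close>. With the mass
    bound this yields 16 * 8192 * 3200 = 419430400.\<close>
  have "1 / (16 * l) * (1 / 8192) * (c * l * u z / 3200) \<le> 1 / (16 * l) * (1 / 8192) * measure \<sigma> (arc b (l / 8))"
    using sJ l by (intro mult_left_mono) auto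
  also have "\<dots> = (\<integral>\<xi>. 1 / (16 * l) * (1 / 8192) * indicator (arc b (l / 8)) \<xi> \<partial>\<sigma>)"
    using sets.sets_into_space[OF arc_in_sets] by (simp add: Int_absorb2)
  also have "\<dots> \<le> (\<integral>\<xi>. D \<xi> \<partial>\<sigma>)"
  proof (rule integral_mono[OF _ iD])
    show "integrable \<sigma> (\<lambda>\<xi>. 1 / (16 * l) * (1 / 8192) * indicator (arc b (l / 8)) \<xi>)"
      by (intro integrable_mult_right integrable_real_indicator) (auto simp: emeasure_eq_measure)
    fix \<xi> assume "\<xi> \<in> space \<sigma>"
    then have \<xi>: "norm \<xi> = 1" by (simp add: space_sigma)
    have P: "0 < poisson z \<xi>" by (rule poisson_pos[OF z \<xi>])
    show "1 / (16 * l) * (1 / 8192) * indicator (arc b (l / 8)) \<xi> \<le> D \<xi>"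
    proof (cases "\<xi> \<in> arc b (l / 8)")
      case True
      then have nr: "norm (\<xi> - z) \<le> 4 * l" using near b(1) by auto
      have "1 / (16 * l) = l / (4 * l)\<^sup>2" using l by (simp add: power2_eq_square)
      also have "\<dots> \<le> poisson z \<xi>"
        unfolding poisson_def using nr ne[OF \<xi>] one_minus_norm_sq_ge[OF z] l
        by (intro frac_le power_mono) (auto simp: l_def)
      finally have p: "1 / (16 * l) \<le> poisson z \<xi>" .
      have "(1 / 64)\<^sup>2 \<le> (norm (1 - \<psi> \<xi>))\<^sup>2" using b(2)[OF True] by (intro power_mono) auto
      then have "1 / 8192 \<le> (norm (1 - \<psi> \<xi>))\<^sup>2 / 2" by (simp add: power2_eq_square)
      then have "1 / (16 * l) * (1 / 8192) \<le> poisson z \<xi> * ((norm (1 - \<psi> \<xi>))\<^sup>2 / 2)"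
        using p P by (intro mult_mono) auto
      then show ?thesis using True D[OF \<xi>] by simp
    next
      case False
      have "0 \<le> D \<xi>" unfolding D[OF \<xi>] using P by simp
      then show ?thesis using False by simp
    qed
  qed
  finally have "c / 419430400 * u z \<le> (1 - hyp_deriv f z) * u z"
    using l by (simp add: uD'[symmetric] algebra_simps)
  then show ?thesis using u_pos[OF z] by simp
qed

end

theorem theorem1:
  fixes f :: "complex \<Rightarrow> complex" and \<alpha> :: complex and \<sigma> :: "complex measure"
    and u :: "complex \<Rightarrow> real"
  assumes "f analytic_on ball 0 1"
    and "f ` ball 0 1 \<subseteq> ball 0 1"
    and "norm \<alpha> = 1"
    and "is_AC_measure f \<alpha> \<sigma>"
    and "\<And>z. z \<in> ball 0 1 \<Longrightarrow> u z = (\<integral>\<xi>. poisson z \<xi> \<partial>\<sigma>)"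
  shows "(contractive f \<longleftrightarrow>
           (\<exists>c>0. \<forall>a l. 0 < l \<and> l \<le> 1 \<longrightarrow>
              measure \<sigma> (arc a l) / arc_len (arc a l) \<ge> c * u (arc_point a l)))
       \<and> (contractive f \<longleftrightarrow> B2_weight u)"
proof -
  interpret clark_measure f \<alpha> \<sigma> u
    using assms by unfold_locales
  have "contractive f"
    if "\<exists>c>0. \<forall>a l. 0 < l \<and> l \<le> 1 \<longrightarrow> c * u (arc_point a l) \<le> measure \<sigma> (arc a l) / arc_len (arc a l)"
  proof -
    from that obtain c where "0 < c"
      "\<And>a l. 0 < l \<and> l \<le> 1 \<Longrightarrow> c * u (arc_point a l) \<le> measure \<sigma> (arc a l) / arc_len (arc a l)"
      by blast
    then have "\<forall>z\<in>ball 0 1. hyp_deriv f z \<le> 1 - c / 419430400" and "1 - c / 419430400 < 1"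
      using arc_bound_imp_hyp_deriv_le[of c] by auto
    then show ?thesis unfolding contractive_def by blast
  qed
  then show ?thesis using contractive_imp_B2_weight B2_weight_imp_arc_bound by blast
qed

end
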